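(* Let a state $\omega_L=(\tau_L,\mathbf{s}_L)\in\Omega$, a left velocity $u_L$ and a speed $\sigma$ be given satisfying the Lax condition $(u_L-\sigma)/c_L>1$. For any given $\mathbf{s}\in\mathcal{C}$, there exists at least one choice of the $N$-tuple of viscosity laws $(\mu_i)_{1\le i\le N}$ (smooth, $\mu_i\ge0$, $\sum_i\mu_i>0$) which yields a traveling wave solution with speed $\sigma$ of the multi-pressure Navier-Stokes system issued from $\omega_L$ and connecting a state $\omega_R=(\tau_R,\mathbf{s}_R)$ in the future with $\mathbf{s}_R=\mathbf{s}$.
   Context: For each $i=1,\dots,N$ the internal energy $e_i(\tau,s_i)$ is a smooth, strictly convex function of the specific volume $\tau>0$ and $s_i\in\mathbb{R}$, with $p_i=-\partial e_i/\partial\tau>0$ and $T_i=\partial e_i/\partial s_i>0$. Write $\mathbf{s}=(s_1,\dots,s_N)$, $e(\tau,\mathbf{s})=\sum_ie_i(\tau,s_i)$, $p(\tau,\mathbf{s})=\sum_ip_i(\tau,s_i)$, $\Omega=\{(\tau,\mathbf{s})\in\mathbb{R}^{N+1}:\tau>0\}$. Thermodynamic assumptions: for each $i$, $e_i\to+\infty$ as $\tau\to0^+$, $e_i\to+\infty$ as $s_i\to+\infty$, $e_i\to0$ as $\tau\to+\infty$, $\partial p_i/\partial s_i>0$, $\partial p_i/\partial\tau\to-\infty$ as $s_i\to+\infty$; for all $(\tau,\mathbf{s})$, $\partial^2p/\partial\tau^2>0$; for each $\mathbf{s}$, $p\to+\infty$ and $\partial p/\partial\tau\to-\infty$ as $\tau\to0^+$,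 and $p\to0$ and $\partial p/\partial\tau\to0$ as $\tau\to+\infty$. The multi-pressure Navier-Stokes system, with $\rho=1/\tau$, velocity $u$ and $\epsilon>0$, is $$\partial_t\rho+\partial_x(\rho u)=0,\quad\partial_t(\rho u)+\partial_x(\rho u^2+p)=\epsilon\,\partial_x\Big(\sum_i\mu_i\,\partial_xu\Big),\quad\partial_t(\rho e_i)+\partial_x(\rho ue_i)+p_i\partial_xu=\epsilon\mu_i(\partial_xu)^2,$$ with viscosities $\mu_i=\mu_i(\tau,s_i)$. Put $c_L^2=-\tau_L^2\partial_\tau p(\tau_L,\mathbf{s}_L)$ and $m=(u_L-\sigma)/\tau_L$, so the Lax condition reads $m>c_L/\tau_L$, i.e. $m>0$ and $m^2+\partial_\tau p(\tau_L,\mathbf{s}_L)>0$. A traveling wave with speed $\sigma$ issued from $\omega_L$ and connecting $\omega_R$ in the future is (up to scaling of $x-\sigma t$ and with $u-\sigma=m\tau$) a nonconstant solution of $$\dot\tau=\frac{\mathcal{F}(\tau,\mathbf{s})}{\mu(\tau,\mathbf{s})},\qquad\dot s_i=\frac{\mu_i(\tau,s_i)}{\mu^2(\tau,\mathbf{s})T_i(\tau,s_i)}\mathcal{F}^2(\tau,\mathbf{s}),\quad1\le i\le N,\qquad\mu:=\sum_i\mu_i,$$ tending to $\omega_L$ at $-\infty$ and to $\omega_R$ at $+\infty$, where $$\mathcal{F}(\tau,\mathbf{s})=p(\tau,\mathbf{s})-p(\tau_L,\mathbf{s}_L)+m^2(\tau-\tau_L).$$ Also let $$\mathcal{H}(\tau,\mathbf{s})=e(\tau,\mathbf{s})-e(\tau_L,\mathbf{s}_L)-\frac{m^2}{2}(\tau^2-\tau_L^2)+(m^2\tau_L+p(\tau_L,\mathbf{s}_L))(\tau-\tau_L).$$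 $\mathcal{S}^N_+=\{\mathbf{a}\in[0,\infty)^N:\|\mathbf{a}\|=1\}$. For $\mathbf{a}\in\mathcal{S}^N_+$, $\Lambda_0(\mathbf{a})$ is the unique $\lambda>0$ for which there exists $\tau>0$ with $\mathcal{F}(\tau,\mathbf{s}_L+\lambda\mathbf{a})=\mathcal{H}(\tau,\mathbf{s}_L+\lambda\mathbf{a})=0$, and $\mathcal{C}=\{\mathbf{s}_L+\Lambda_0(\mathbf{a})\mathbf{a}:\mathbf{a}\in\mathcal{S}^N_+\}$. *)

theory Defs
  imports "HOL-Analysis.Analysis"
begin

text \<open>To be used on open sets only: the derivatives are unrestricted Frechet derivatives.\<close>

fun Ck_on :: "nat \<Rightarrow> 'a::euclidean_space set \<Rightarrow> ('a \<Rightarrow> 'b::real_normed_vector) \<Rightarrow> bool" where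
  "Ck_on 0 S f \<longleftrightarrow> continuous_on S f"
| "Ck_on (Suc k) S f \<longleftrightarrow>
     (\<forall>x\<in>S. f differentiable (at x)) \<and> (\<forall>v. Ck_on k S (\<lambda>x. frechet_derivative f (at x) v))"

definition smooth_on :: "'a::euclidean_space set \<Rightarrow> ('a \<Rightarrow> 'b::real_normed_vector) \<Rightarrow> bool" where
  "smooth_on S f \<longleftrightarrow> (\<forall>k. Ck_on k S f)"

definition strictly_convex_on :: "'a::real_vector set \<Rightarrow> ('a \<Rightarrow> real) \<Rightarrow> bool" where
  "strictly_convex_on S f \<longleftrightarrow> convex S \<and>
     (\<forall>x\<in>S. \<forall>y\<in>S. \<forall>t. x \<noteq> y \<and> 0 < t \<and> t < 1 \<longrightarrow>
        f ((1 - t) *\<^sub>R x + t *\<^sub>R y) < (1 - t) * f x + t * f y)"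

text \<open>\<open>e i \<tau> r\<close> is the \<open>i\<close>-th internal energy at specific volume \<open>\<tau>\<close> and entropy \<open>r\<close>; the
  number of entropies is \<open>CARD('n)\<close>. Only the values for \<open>\<tau> > 0\<close> are meaningful.\<close>

definition pres :: "('n \<Rightarrow> real \<Rightarrow> real \<Rightarrow> real) \<Rightarrow> 'n \<Rightarrow> real \<Rightarrow> real \<Rightarrow> real" where
  "pres e i \<tau> r = - deriv (\<lambda>t. e i t r) \<tau>"

definition temp :: "('n \<Rightarrow> real \<Rightarrow> real \<Rightarrow> real) \<Rightarrow> 'n \<Rightarrow> real \<Rightarrow> real \<Rightarrow> real" where
  "temp e i \<tau> r = deriv (\<lambda>q. e i \<tau> q) r"

definition total_energy :: "('n::finite \<Rightarrow> real \<Rightarrow> real \<Rightarrow> real) \<Rightarrow> real \<Rightarrow> real^'n \<Rightarrow> real" where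
  "total_energy e \<tau> s = (\<Sum>i\<in>UNIV. e i \<tau> (s $ i))"

definition total_pres :: "('n::finite \<Rightarrow> real \<Rightarrow> real \<Rightarrow> real) \<Rightarrow> real \<Rightarrow> real^'n \<Rightarrow> real" where
  "total_pres e \<tau> s = (\<Sum>i\<in>UNIV. pres e i \<tau> (s $ i))"

definition total_pres_dtau :: "('n::finite \<Rightarrow> real \<Rightarrow> real \<Rightarrow> real) \<Rightarrow> real \<Rightarrow> real^'n \<Rightarrow> real" where
  "total_pres_dtau e \<tau> s = deriv (\<lambda>t. total_pres e t s) \<tau>"

definition internal_energies :: "('n::finite \<Rightarrow> real \<Rightarrow> real \<Rightarrow> real) \<Rightarrow> bool" where
  "internal_energies e \<longleftrightarrow> (\<forall>i.
     smooth_on ({0<..} \<times> UNIV) (\<lambda>(\<tau>, r). e i \<tau> r) \<and>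
     strictly_convex_on ({0<..} \<times> UNIV) (\<lambda>(\<tau>, r). e i \<tau> r) \<and>
     (\<forall>\<tau> r. 0 < \<tau> \<longrightarrow> 0 < pres e i \<tau> r \<and> 0 < temp e i \<tau> r))"

definition thermodynamic_assumptions :: "('n::finite \<Rightarrow> real \<Rightarrow> real \<Rightarrow> real) \<Rightarrow> bool" where
  "thermodynamic_assumptions e \<longleftrightarrow>
     (\<forall>i.
        (\<forall>r. LIM \<tau> at_right 0. e i \<tau> r :> at_top) \<and>
        (\<forall>\<tau>>0. LIM r at_top. e i \<tau> r :> at_top) \<and>
        (\<forall>r. ((\<lambda>\<tau>. e i \<tau> r) \<longlongrightarrow> 0) at_top) \<and>
        (\<forall>\<tau>>0. \<forall>r. 0 < deriv (\<lambda>q. pres e i \<tau> q) r) \<and>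
        (\<forall>\<tau>>0. LIM r at_top. deriv (\<lambda>t. pres e i t r) \<tau> :> at_bot)) \<and>
     (\<forall>\<tau>>0. \<forall>s. 0 < deriv (\<lambda>t. total_pres_dtau e t s) \<tau>) \<and>
     (\<forall>s.
        (LIM \<tau> at_right 0. total_pres e \<tau> s :> at_top) \<and>
        (LIM \<tau> at_right 0. total_pres_dtau e \<tau> s :> at_bot) \<and>
        ((\<lambda>\<tau>. total_pres e \<tau> s) \<longlongrightarrow> 0) at_top \<and>
        ((\<lambda>\<tau>. total_pres_dtau e \<tau> s) \<longlongrightarrow> 0) at_top)"

definition sound_speed :: "('n::finite \<Rightarrow> real \<Rightarrow> real \<Rightarrow> real) \<Rightarrow> real \<Rightarrow> real^'n \<Rightarrow> real" where
  "sound_speed e \<tau> s = sqrt (- (\<tau>\<^sup>2 * total_pres_dtau e \<tau> s))"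

definition mass_flux :: "real \<Rightarrow> real \<Rightarrow> real \<Rightarrow> real" where
  "mass_flux \<tau>L uL \<sigma> = (uL - \<sigma>) / \<tau>L"

definition jumpF ::
  "('n::finite \<Rightarrow> real \<Rightarrow> real \<Rightarrow> real) \<Rightarrow> real \<Rightarrow> real \<Rightarrow> real^'n \<Rightarrow> real \<Rightarrow> real^'n \<Rightarrow> real" where
  "jumpF e m \<tau>L sL \<tau> s = total_pres e \<tau> s - total_pres e \<tau>L sL + m\<^sup>2 * (\<tau> - \<tau>L)"

definition jumpH ::
  "('n::finite \<Rightarrow> real \<Rightarrow> real \<Rightarrow> real) \<Rightarrow> real \<Rightarrow> real \<Rightarrow> real^'n \<Rightarrow> real \<Rightarrow> real^'n \<Rightarrow> real" where
  "jumpH e m \<tau>L sL \<tau> s =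
     total_energy e \<tau> s - total_energy e \<tau>L sL - m\<^sup>2 / 2 * (\<tau>\<^sup>2 - \<tau>L\<^sup>2)
     + (m\<^sup>2 * \<tau>L + total_pres e \<tau>L sL) * (\<tau> - \<tau>L)"

definition sphere_plus :: "(real^'n) set" where
  "sphere_plus = {a. (\<forall>i. 0 \<le> a $ i) \<and> norm a = 1}"

text \<open>Under the Lax condition and the thermodynamic assumptions the description below determines
  a unique number for every \<open>a \<in> sphere_plus\<close>.\<close>

definition Lambda0 ::
  "('n::finite \<Rightarrow> real \<Rightarrow> real \<Rightarrow> real) \<Rightarrow> real \<Rightarrow> real \<Rightarrow> real^'n \<Rightarrow> real^'n \<Rightarrow> real" where
  "Lambda0 e m \<tau>L sL a = (THE lam. 0 < lam \<and>
     (\<exists>\<tau>>0. jumpF e m \<tau>L sL \<tau> (sL + lam *\<^sub>R a) = 0 \<and>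
            jumpH e m \<tau>L sL \<tau> (sL + lam *\<^sub>R a) = 0))"

definition entropy_set ::
  "('n::finite \<Rightarrow> real \<Rightarrow> real \<Rightarrow> real) \<Rightarrow> real \<Rightarrow> real \<Rightarrow> real^'n \<Rightarrow> (real^'n) set" where
  "entropy_set e m \<tau>L sL = (\<lambda>a. sL + Lambda0 e m \<tau>L sL a *\<^sub>R a) ` sphere_plus"

definition viscosity_laws :: "('n::finite \<Rightarrow> real \<Rightarrow> real \<Rightarrow> real) \<Rightarrow> bool" where
  "viscosity_laws \<mu> \<longleftrightarrow>
     (\<forall>i. smooth_on ({0<..} \<times> UNIV) (\<lambda>(\<tau>, r). \<mu> i \<tau> r) \<and>
          (\<forall>\<tau>>0. \<forall>r. 0 \<le> \<mu> i \<tau> r)) \<and>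
     (\<forall>\<tau>>0. \<forall>s :: real^'n. 0 < (\<Sum>i\<in>UNIV. \<mu> i \<tau> (s $ i)))"

definition total_visc :: "('n::finite \<Rightarrow> real \<Rightarrow> real \<Rightarrow> real) \<Rightarrow> real \<Rightarrow> real^'n \<Rightarrow> real" where
  "total_visc \<mu> \<tau> s = (\<Sum>i\<in>UNIV. \<mu> i \<tau> (s $ i))"

definition Dt :: "(real \<Rightarrow> real \<Rightarrow> real) \<Rightarrow> real \<Rightarrow> real \<Rightarrow> real" where
  "Dt f t x = deriv (\<lambda>t'. f t' x) t"

definition Dx :: "(real \<Rightarrow> real \<Rightarrow> real) \<Rightarrow> real \<Rightarrow> real \<Rightarrow> real" where
  "Dx f t x = deriv (\<lambda>x'. f t x') x"

text \<open>Classical solutions on the whole \<open>(t, x)\<close>-plane, with density \<open>\<rho> = 1 / \<tau>\<close>. The required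
  regularity ensures that every derivative below is a genuine one.\<close>

definition navier_stokes_solution ::
  "('n::finite \<Rightarrow> real \<Rightarrow> real \<Rightarrow> real) \<Rightarrow> ('n \<Rightarrow> real \<Rightarrow> real \<Rightarrow> real) \<Rightarrow> real \<Rightarrow>
   (real \<Rightarrow> real \<Rightarrow> real) \<Rightarrow> (real \<Rightarrow> real \<Rightarrow> real) \<Rightarrow> (real \<Rightarrow> real \<Rightarrow> real^'n) \<Rightarrow> bool" where
  "navier_stokes_solution e \<mu> eps \<tau> u s \<longleftrightarrow>
     Ck_on 2 UNIV (\<lambda>(t, x). \<tau> t x) \<and>
     Ck_on 2 UNIV (\<lambda>(t, x). u t x) \<and>
     Ck_on 2 UNIV (\<lambda>(t, x). s t x) \<and>
     (\<forall>t x. 0 < \<tau> t x) \<and>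
     (let \<rho> = (\<lambda>t x. 1 / \<tau> t x);
          E = (\<lambda>i t x. e i (\<tau> t x) (s t x $ i));
          P = (\<lambda>t x. total_pres e (\<tau> t x) (s t x))
      in \<forall>t x.
        Dt \<rho> t x + Dx (\<lambda>t x. \<rho> t x * u t x) t x = 0 \<and>
        Dt (\<lambda>t x. \<rho> t x * u t x) t x + Dx (\<lambda>t x. \<rho> t x * (u t x)\<^sup>2 + P t x) t x
          = eps * Dx (\<lambda>t x. total_visc \<mu> (\<tau> t x) (s t x) * Dx u t x) t x \<and>
        (\<forall>i. Dt (\<lambda>t x. \<rho> t x * E i t x) t x + Dx (\<lambda>t x. \<rho> t x * u t x * E i t x) t x
               + pres e i (\<tau> t x) (s t x $ i) * Dx u t x
             = eps * \<mu> i (\<tau> t x) (s t x $ i) * (Dx u t x)\<^sup>2))"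

definition wave_profile ::
  "('n::finite \<Rightarrow> real \<Rightarrow> real \<Rightarrow> real) \<Rightarrow> ('n \<Rightarrow> real \<Rightarrow> real \<Rightarrow> real) \<Rightarrow> real \<Rightarrow>
   real \<times> (real^'n) \<Rightarrow> real \<times> (real^'n) \<Rightarrow> (real \<Rightarrow> real) \<Rightarrow> (real \<Rightarrow> real^'n) \<Rightarrow> bool" where
  "wave_profile e \<mu> m \<omega>L \<omega>R \<tau> s \<longleftrightarrow>
     (let F = jumpF e m (fst \<omega>L) (snd \<omega>L) in
       (\<forall>\<xi>. 0 < \<tau> \<xi> \<and>
         (\<tau> has_real_derivative F (\<tau> \<xi>) (s \<xi>) / total_visc \<mu> (\<tau> \<xi>) (s \<xi>)) (at \<xi>) \<and>
         (\<forall>i. ((\<lambda>z. s z $ i) has_real_derivative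
            \<mu> i (\<tau> \<xi>) (s \<xi> $ i) / ((total_visc \<mu> (\<tau> \<xi>) (s \<xi>))\<^sup>2 * temp e i (\<tau> \<xi>) (s \<xi> $ i))
              * (F (\<tau> \<xi>) (s \<xi>))\<^sup>2) (at \<xi>)))) \<and>
     \<not> (\<lambda>\<xi>. (\<tau> \<xi>, s \<xi>)) constant_on UNIV \<and>
     ((\<lambda>\<xi>. (\<tau> \<xi>, s \<xi>)) \<longlongrightarrow> \<omega>L) at_bot \<and>
     ((\<lambda>\<xi>. (\<tau> \<xi>, s \<xi>)) \<longlongrightarrow> \<omega>R) at_top"

text \<open>Integrating the mass equation gives \<open>u - \<sigma> = m \<tau>\<close>, and integrating the momentum equation
  then gives \<open>eps m \<mu> d\<tau>/d(x - \<sigma> t) = F\<close>; so the variable that normalises the profile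
  equations is \<open>(x - \<sigma> t) / (eps m)\<close>.\<close>

definition traveling_wave ::
  "('n::finite \<Rightarrow> real \<Rightarrow> real \<Rightarrow> real) \<Rightarrow> ('n \<Rightarrow> real \<Rightarrow> real \<Rightarrow> real) \<Rightarrow> real \<Rightarrow> real \<Rightarrow> real \<Rightarrow>
   real \<times> (real^'n) \<Rightarrow> real \<times> (real^'n) \<Rightarrow>
   (real \<Rightarrow> real \<Rightarrow> real) \<Rightarrow> (real \<Rightarrow> real \<Rightarrow> real) \<Rightarrow> (real \<Rightarrow> real \<Rightarrow> real^'n) \<Rightarrow> bool" where
  "traveling_wave e \<mu> eps uL \<sigma> \<omega>L \<omega>R \<tau> u s \<longleftrightarrow>
     (let m = mass_flux (fst \<omega>L) uL \<sigma> in
       navier_stokes_solution e \<mu> eps \<tau> u s \<and>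
       (\<exists>\<tau>p sp. wave_profile e \<mu> m \<omega>L \<omega>R \<tau>p sp \<and>
          (\<forall>t x. let \<xi> = (x - \<sigma> * t) / (eps * m) in
             \<tau> t x = \<tau>p \<xi> \<and> s t x = sp \<xi> \<and> u t x = \<sigma> + m * \<tau>p \<xi>)))"

end

theory Submission
  imports Defs
begin

text \<open>Given \<open>s\<^sub>R = s\<^sub>L + \<Lambda>\<^sub>0(a) a\<close>, take the viscosities \<open>\<mu>\<^sub>i = a\<^sub>i T\<^sub>i\<close>. Then \<open>\<mu>\<^sub>i / T\<^sub>i = a\<^sub>i\<close>, so the profile
  stays on the ray \<open>s\<^sub>L + \<lambda> a\<close> and the system becomes \<open>\<tau>' = F / \<mu>\<close>, \<open>\<lambda>' = (F / \<mu>)\<^sup>2\<close>, where \<open>\<mu>\<close> is the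
  \<open>\<lambda>\<close>-derivative of \<open>H\<close>. As \<open>-F\<close> is its \<open>\<tau>\<close>-derivative, \<open>H\<close> is conserved, and the orbit lies on the
  curve \<open>H = 0\<close>, a graph \<open>\<lambda> = \<phi>(\<tau>)\<close> with \<open>\<phi>' = F / \<mu>\<close>. This graph leaves \<open>(\<tau>\<^sub>L, 0)\<close> upwards to the
  left and returns to \<open>\<lambda> = 0\<close>, so \<open>\<phi>\<close> has an interior maximum, which is a common zero of \<open>F\<close> and \<open>H\<close>.
  Convexity of the pressure makes it the only one with \<open>\<lambda> > 0\<close>: its height is \<open>\<Lambda>\<^sub>0(a)\<close>, and the scalar
  equation \<open>\<tau>' = (F / \<mu>)(\<tau>, \<phi>(\<tau>))\<close> joins \<open>\<tau>\<^sub>L\<close> to the abscissa of the maximum.\<close>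

section \<open>Smooth functions on the half-plane\<close>

lemma Ck_on_imp_continuous_on: "Ck_on k S f \<Longrightarrow> continuous_on S f"
  by (cases k) (simp_all add: continuous_at_imp_continuous_on differentiable_imp_continuous_within)

text \<open>On an open set, agreement of two functions passes to their Frechet derivatives, which
  lets the induction continue.\<close>

lemma Ck_on_cong:
  assumes "open S" "Ck_on k S f" "\<And>x. x \<in> S \<Longrightarrow> f x = g x"
  shows "Ck_on k S g"
  using assms(2,3)
proof (induction k arbitrary: f g)
  case 0
  then show ?case by (auto intro: continuous_on_eq)
next
  case (Suc k)
  have g: "(g has_derivative frechet_derivative f (at x)) (at x)" if "x \<in> S" for x
  proof (rule has_derivative_transform_within_open[OF _ assms(1) that])
    show "(f has_derivative frechet_derivative f (at x)) (at x)"
      using Suc.prems that by (simp add: frechet_derivative_works)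
  qed (rule Suc.prems(2))
  then have "frechet_derivative g (at x) = frechet_derivative f (at x)" if "x \<in> S" for x
    using frechet_derivative_at[OF g[OF that]] by simp
  then have "Ck_on k S (\<lambda>x. frechet_derivative g (at x) v)" for v
    using Suc.IH[of "\<lambda>x. frechet_derivative f (at x) v"] Suc.prems(1) by simp
  then show ?case using g differentiableI unfolding Ck_on.simps(2) by blast
qed

text \<open>The introduction rule behind the inductions below: by uniqueness of derivatives, an
  explicit \<open>f'\<close> may replace \<open>frechet_derivative\<close>.\<close>

lemma Ck_on_SucI:
  assumes "open S" "\<And>x. x \<in> S \<Longrightarrow> (f has_derivative f' x) (at x)"
    and "\<And>v. Ck_on k S (\<lambda>x. f' x v)"
  shows "Ck_on (Suc k) S f"
proof -
  have "frechet_derivative f (at x) = f' x" if "x \<in> S" for x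
    using frechet_derivative_at[OF assms(2)[OF that]] by simp
  then have "Ck_on k S (\<lambda>x. frechet_derivative f (at x) v)" for v
    by (intro Ck_on_cong[OF assms(1) assms(3)[of v]]) auto
  then show ?thesis using assms(2) differentiableI unfolding Ck_on.simps(2) by blast
qed

lemma Ck_on_SucD:
  assumes "Ck_on (Suc k) S f" "x \<in> S"
  shows "(f has_derivative frechet_derivative f (at x)) (at x)"
  using assms frechet_derivative_works by auto

lemma Ck_on_const: "open S \<Longrightarrow> Ck_on k S (\<lambda>x. c)"
proof (induction k arbitrary: c)
  case (Suc k)
  then show ?case by (intro Ck_on_SucI[where f' = "\<lambda>x v. 0"]) simp_all
qed simp

lemma Ck_on_add:
  assumes "open S" "Ck_on k S f" "Ck_on k S g"
  shows "Ck_on k S (\<lambda>x. f x + g x)"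
  using assms(2,3)
proof (induction k arbitrary: f g)
  case (Suc k)
  show ?case
  proof (rule Ck_on_SucI[OF assms(1)])
    show "((\<lambda>x. f x + g x) has_derivative
        (\<lambda>v. frechet_derivative f (at x) v + frechet_derivative g (at x) v)) (at x)" if "x \<in> S" for x
      using has_derivative_add[OF Ck_on_SucD Ck_on_SucD] Suc.prems that by blast
    show "Ck_on k S (\<lambda>x. frechet_derivative f (at x) v + frechet_derivative g (at x) v)" for v
      by (rule Suc.IH) (use Suc.prems in simp_all)
  qed
qed (simp add: continuous_on_add)

lemma Ck_on_sum:
  assumes "open S" "finite I" "\<And>i. i \<in> I \<Longrightarrow> Ck_on k S (f i)"
  shows "Ck_on k S (\<lambda>x. \<Sum>i\<in>I. f i x)"
  using assms(2,3)
proof (induction I)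
  case (insert i I)
  then have "Ck_on k S (\<lambda>x. f i x + (\<Sum>i\<in>I. f i x))"
    by (intro Ck_on_add[OF assms(1)]) blast+
  with insert show ?case by simp
qed (simp add: Ck_on_const[OF assms(1)])

lemma Ck_on_cmult:
  fixes f :: "'a::euclidean_space \<Rightarrow> real"
  assumes "open S" "Ck_on k S f"
  shows "Ck_on k S (\<lambda>x. c * f x)"
  using assms(2)
proof (induction k arbitrary: f)
  case (Suc k)
  show ?case
  proof (rule Ck_on_SucI[OF assms(1)])
    show "((\<lambda>x. c * f x) has_derivative (\<lambda>v. c * frechet_derivative f (at x) v)) (at x)" if "x \<in> S" for x
      using has_derivative_mult_right[OF Ck_on_SucD] Suc.prems that by blast
    show "Ck_on k S (\<lambda>x. c * frechet_derivative f (at x) v)" for v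
      by (rule Suc.IH) (use Suc.prems in simp)
  qed
qed (simp add: continuous_on_mult)

text \<open>The derivative \<open>L\<close> of \<open>A\<close> is the same at every point, so each
  directional derivative of the composite is again a function composed with \<open>A\<close>, and
  the induction needs no product rule.\<close>

lemma Ck_on_compose_affine:
  assumes "open S" "open S'"
    and A: "\<And>x. (A has_derivative L) (at x)" "\<And>x. x \<in> S' \<Longrightarrow> A x \<in> S" and "Ck_on k S f"
  shows "Ck_on k S' (\<lambda>x. f (A x))"
  using assms(5)
proof (induction k arbitrary: f)
  case 0
  have "continuous_on S' A"
    using A(1) by (meson continuous_at_imp_continuous_on has_derivative_continuous)
  with 0 A(2) show ?case by (auto intro: continuous_on_compose2[of S f])
next
  case (Suc k)
  show ?case
  proof (rule Ck_on_SucI[OF assms(2)])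
    show "((\<lambda>x. f (A x)) has_derivative (\<lambda>v. frechet_derivative f (at (A x)) (L v))) (at x)"
      if "x \<in> S'" for x
      using has_derivative_compose[OF A(1) Ck_on_SucD[OF Suc.prems A(2)[OF that]]] .
    show "Ck_on k S' (\<lambda>x. frechet_derivative f (at (A x)) (L v))" for v
      by (rule Suc.IH) (use Suc.prems in simp)
  qed
qed

lemma smooth_on_cong:
  "open S \<Longrightarrow> smooth_on S f \<Longrightarrow> (\<And>x. x \<in> S \<Longrightarrow> f x = g x) \<Longrightarrow> smooth_on S g"
  unfolding smooth_on_def using Ck_on_cong by blast

lemma smooth_on_frechet_derivative:
  "smooth_on S f \<Longrightarrow> smooth_on S (\<lambda>x. frechet_derivative f (at x) v)"
  unfolding smooth_on_def using Ck_on.simps(2) by blast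

lemma smooth_on_imp_continuous_on: "smooth_on S f \<Longrightarrow> continuous_on S f"
  unfolding smooth_on_def using Ck_on_imp_continuous_on by blast

lemma smooth_on_imp_has_derivative:
  "smooth_on S f \<Longrightarrow> x \<in> S \<Longrightarrow> (f has_derivative frechet_derivative f (at x)) (at x)"
  unfolding smooth_on_def using Ck_on_SucD by blast

section \<open>Partial derivatives and chain rules on the half-plane\<close>

definition D1 :: "(real \<Rightarrow> real \<Rightarrow> real) \<Rightarrow> real \<Rightarrow> real \<Rightarrow> real" where
  "D1 f x y = deriv (\<lambda>t. f t y) x"

definition D2 :: "(real \<Rightarrow> real \<Rightarrow> real) \<Rightarrow> real \<Rightarrow> real \<Rightarrow> real" where
  "D2 f x y = deriv (\<lambda>r. f x r) y"

abbreviation smooth2 :: "(real \<Rightarrow> real \<Rightarrow> real) \<Rightarrow> bool" where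
  "smooth2 f \<equiv> smooth_on ({0<..} \<times> UNIV) (\<lambda>(x, y). f x y)"

lemma open_halfplane: "open ({0::real<..} \<times> (UNIV :: real set))"
  by (intro open_Times) auto

text \<open>Restricting the Frechet derivative to coordinate lines ties the one-variable
  \<open>deriv\<close> of \<open>pres\<close> and \<open>temp\<close> to the derivatives that
  \<open>smooth_on\<close> controls.\<close>

lemma partial_derivatives:
  assumes "smooth2 f" "0 < x"
  shows "D1 f x y = frechet_derivative (\<lambda>(x, y). f x y) (at (x, y)) (1, 0)"
    and "D2 f x y = frechet_derivative (\<lambda>(x, y). f x y) (at (x, y)) (0, 1)"
proof -
  let ?D = "frechet_derivative (\<lambda>(x, y). f x y) (at (x, y))"
  have D: "((\<lambda>(x, y). f x y) has_derivative ?D) (at (x, y))"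
    using assms by (intro smooth_on_imp_has_derivative[OF assms(1)]) auto
  have lin: "linear ?D" using D has_derivative_linear by blast
  have "((\<lambda>t. f t y) has_derivative (\<lambda>h. ?D (h, 0))) (at x)"
    using has_derivative_compose[of "\<lambda>t. (t, y)" "\<lambda>h. (h, 0)" x UNIV, OF _ D]
    by (simp add: has_derivative_Pair)
  moreover have "?D (h, 0) = ?D (1, 0) * h" for h
    using linear_scale[OF lin, of h "(1, 0)"] by simp
  then have "(\<lambda>h. ?D (h, 0)) = (*) (?D (1, 0))" by (rule ext)
  ultimately have "((\<lambda>t. f t y) has_real_derivative ?D (1, 0)) (at x)"
    by (simp add: has_field_derivative_def)
  then show "D1 f x y = ?D (1, 0)" unfolding D1_def by (rule DERIV_imp_deriv)
  have "((\<lambda>t. f x t) has_derivative (\<lambda>h. ?D (0, h))) (at y)"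
    using has_derivative_compose[of "\<lambda>t. (x, t)" "\<lambda>h. (0, h)" y UNIV, OF _ D]
    by (simp add: has_derivative_Pair)
  moreover have "?D (0, h) = ?D (0, 1) * h" for h
    using linear_scale[OF lin, of h "(0, 1)"] by simp
  then have "(\<lambda>h. ?D (0, h)) = (*) (?D (0, 1))" by (rule ext)
  ultimately have "((\<lambda>t. f x t) has_real_derivative ?D (0, 1)) (at y)"
    by (simp add: has_field_derivative_def)
  then show "D2 f x y = ?D (0, 1)" unfolding D2_def by (rule DERIV_imp_deriv)
qed

lemma smooth2_has_derivative:
  assumes "smooth2 f" "0 < x"
  shows "((\<lambda>(x, y). f x y) has_derivative (\<lambda>(h, k). D1 f x y * h + D2 f x y * k)) (at (x, y))"
proof -
  let ?D = "frechet_derivative (\<lambda>(x, y). f x y) (at (x, y))"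
  have D: "((\<lambda>(x, y). f x y) has_derivative ?D) (at (x, y))"
    using assms by (intro smooth_on_imp_has_derivative[OF assms(1)]) auto
  then have "linear ?D" using has_derivative_linear by blast
  then have "?D (h, k) = h * ?D (1, 0) + k * ?D (0, 1)" for h k
    using linear_add[of ?D "h *\<^sub>R (1, 0)" "k *\<^sub>R (0, 1)"] linear_scale[of ?D h "(1, 0)"]
      linear_scale[of ?D k "(0, 1)"] by simp
  then have "?D = (\<lambda>(h, k). D1 f x y * h + D2 f x y * k)"
    unfolding partial_derivatives[OF assms] by (intro ext) (metis (lifting) mult.commute old.prod.case old.prod.exhaust)
  with D show ?thesis by simp
qed

lemma smooth2_D1: "smooth2 f \<Longrightarrow> smooth2 (D1 f)"
  by (rule smooth_on_cong[OF open_halfplane smooth_on_frechet_derivative[of _ _ "(1, 0)"]])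
     (auto simp: partial_derivatives)

lemma smooth2_D2: "smooth2 f \<Longrightarrow> smooth2 (D2 f)"
  by (rule smooth_on_cong[OF open_halfplane smooth_on_frechet_derivative[of _ _ "(0, 1)"]])
     (auto simp: partial_derivatives)

lemma smooth2_chain:
  assumes "smooth2 f" "0 < X t"
    and "(X has_real_derivative X') (at t)" "(Y has_real_derivative Y') (at t)"
  shows "((\<lambda>t. f (X t) (Y t)) has_real_derivative D1 f (X t) (Y t) * X' + D2 f (X t) (Y t) * Y') (at t)"
proof -
  have "((\<lambda>t. (X t, Y t)) has_derivative (\<lambda>h. (X' * h, Y' * h))) (at t)"
    using assms by (intro has_derivative_Pair) (auto simp: has_field_derivative_def)
  from has_derivative_compose[OF this smooth2_has_derivative[OF assms(1,2)]]
  show ?thesis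
    by (auto simp: has_field_derivative_def algebra_simps elim!: has_derivative_eq_rhs)
qed

lemma smooth2_continuous_on:
  assumes "smooth2 f" "continuous_on A X" "continuous_on A Y" "\<And>t. t \<in> A \<Longrightarrow> 0 < X t"
  shows "continuous_on A (\<lambda>t. f (X t) (Y t))"
proof -
  have "(\<lambda>t. (X t, Y t)) ` A \<subseteq> {0<..} \<times> UNIV" using assms(4) by auto
  from continuous_on_compose2[OF smooth_on_imp_continuous_on[OF assms(1)]
      continuous_on_Pair[OF assms(2,3)] this]
  show ?thesis by simp
qed

lemma smooth2_D1_works:
  "smooth2 f \<Longrightarrow> 0 < x \<Longrightarrow> ((\<lambda>t. f t y) has_real_derivative D1 f x y) (at x)"
  using smooth2_chain[of f "\<lambda>t. t" x 1 "\<lambda>t. y" 0] by simp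

lemma smooth2_D2_works:
  "smooth2 f \<Longrightarrow> 0 < x \<Longrightarrow> ((\<lambda>t. f x t) has_real_derivative D2 f x y) (at y)"
  using smooth2_chain[of f "\<lambda>t. x" y 0 "\<lambda>t. t" 1] by simp

text \<open>Makes the total energy smooth along a ray of entropies: each summand is a smooth
  function after an affine map of the half-plane.\<close>

lemma smooth2_sum_compose_affine:
  fixes f :: "'i::finite \<Rightarrow> real \<Rightarrow> real \<Rightarrow> real"
  assumes "\<And>i. smooth2 (f i)"
  shows "smooth2 (\<lambda>x y. \<Sum>i\<in>UNIV. f i x (c i + y * d i))"
proof -
  have "Ck_on k ({0<..} \<times> UNIV) (\<lambda>z. case (fst z, c i + snd z * d i) of (x, y) \<Rightarrow> f i x y)" for k i
  proof (rule Ck_on_compose_affine[OF open_halfplane open_halfplane])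
    show "((\<lambda>z. (fst z, c i + snd z * d i)) has_derivative (\<lambda>z. (fst z, snd z * d i))) (at z)" for z
      by (rule has_derivative_Pair) (auto intro!: derivative_eq_intros)
    show "Ck_on k ({0<..} \<times> UNIV) (\<lambda>(x, y). f i x y)"
      using assms[of i] unfolding smooth_on_def by blast
  qed (simp add: mem_Times_iff)
  then have "Ck_on k ({0<..} \<times> UNIV) (\<lambda>z. f i (fst z) (c i + snd z * d i))" for k i
    by simp
  then have "Ck_on k ({0<..} \<times> UNIV) (\<lambda>z. \<Sum>i\<in>UNIV. f i (fst z) (c i + snd z * d i))" for k
    by (rule Ck_on_sum[OF open_halfplane finite])
  then have "smooth_on ({0<..} \<times> UNIV) (\<lambda>z. \<Sum>i\<in>UNIV. f i (fst z) (c i + snd z * d i))"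
    unfolding smooth_on_def by blast
  then show ?thesis by (simp only: case_prod_unfold)
qed

text \<open>Differentiating in direction \<open>v\<close> only produces the constant factor
  \<open>l v\<close>, so two derivatives of \<open>w\<close> suffice.\<close>

lemma Ck_on_2_plane_wave:
  fixes w :: "real \<Rightarrow> 'b::real_normed_vector"
  assumes "\<And>r. (w has_vector_derivative w1 r) (at r)" "\<And>r. (w1 has_vector_derivative w2 r) (at r)"
    and "continuous_on UNIV w2" "bounded_linear (l :: 'a::euclidean_space \<Rightarrow> real)"
  shows "Ck_on 2 UNIV (\<lambda>z. w (l z))"
proof -
  have l: "(l has_derivative l) (at z)" for z
    using assms(4) by (rule bounded_linear.has_derivative) (auto intro: derivative_eq_intros)
  have cl: "continuous_on UNIV l" using assms(4) linear_continuous_on by blast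
  have cw2: "Ck_on 0 UNIV (\<lambda>z. l v *\<^sub>R l v' *\<^sub>R w2 (l z))" for v v'
    using continuous_on_compose2[OF assms(3) cl] by (auto intro!: continuous_intros)
  have w2: "((\<lambda>z. l v *\<^sub>R w1 (l z)) has_derivative (\<lambda>v'. l v *\<^sub>R l v' *\<^sub>R w2 (l z))) (at z)" for v z
    using has_derivative_compose[OF l assms(2)[unfolded has_vector_derivative_def]]
    by (rule has_derivative_scaleR_right)
  have w1: "Ck_on (Suc 0) UNIV (\<lambda>z. l v *\<^sub>R w1 (l z))" for v
    by (rule Ck_on_SucI[OF open_UNIV w2 cw2])
  have "((\<lambda>z. w (l z)) has_derivative (\<lambda>v. l v *\<^sub>R w1 (l z))) (at z)" for z
    using has_derivative_compose[OF l assms(1)[unfolded has_vector_derivative_def]] .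
  from Ck_on_SucI[OF open_UNIV this w1] show ?thesis by (simp add: numeral_2_eq_2)
qed

section \<open>A scalar autonomous equation\<close>

text \<open>The orbit is the inverse of an antiderivative of \<open>1 / g\<close>; since \<open>g\<close> is Lipschitz and
  vanishes at both ends, that antiderivative is unbounded there, so the orbit is global.\<close>

lemma decreasing_heteroclinic_orbit:
  fixes g g' :: "real \<Rightarrow> real"
  assumes "a < b" and g: "\<And>x. a \<le> x \<Longrightarrow> x \<le> b \<Longrightarrow> (g has_real_derivative g' x) (at x)"
    and "continuous_on {a..b} g'" "g a = 0" "g b = 0" and neg: "\<And>x. a < x \<Longrightarrow> x < b \<Longrightarrow> g x < 0"
  obtains X where "\<forall>t. a < X t \<and> X t < b \<and> (X has_real_derivative g (X t)) (at t)"
    "(X \<longlongrightarrow> b) at_bot" "(X \<longlongrightarrow> a) at_top"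
proof -
  \<comment> \<open>A Lipschitz constant of \<open>g\<close> on the compact interval; the maximum
    with 1 makes it safe to divide by.\<close>
  obtain C where C: "0 < C" "\<And>x. a \<le> x \<Longrightarrow> x \<le> b \<Longrightarrow> \<bar>g' x\<bar> \<le> C"
  proof -
    have "bounded (g' ` {a..b})"
      using assms(3) compact_continuous_image compact_imp_bounded by blast
    then obtain B where "\<forall>x\<in>{a..b}. \<bar>g' x\<bar> \<le> B" by (auto simp: bounded_iff)
    then show ?thesis by (intro that[of "max 1 B"]) (auto simp: le_max_iff_disj)
  qed
  have lip_a: "- g x \<le> C * (x - a)" if x: "a < x" "x < b" for x
  proof -
    obtain z where z: "a < z" "z < x" "g x - g a = (x - a) * g' z"
      using MVT2[OF x(1) g] x by force
    have "- g' z \<le> C" using C(2)[of z] z x by auto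
    then show ?thesis using z x assms(4) mult_left_mono[of "- g' z" C "x - a"]
      by (simp add: mult.commute)
  qed
  have lip_b: "- g x \<le> C * (b - x)" if x: "a < x" "x < b" for x
  proof -
    obtain z where z: "x < z" "z < b" "g b - g x = (b - x) * g' z"
      using MVT2[OF x(2) g] x by force
    have "g' z \<le> C" using C(2)[of z] z x by auto
    then show ?thesis using z x assms(5) mult_left_mono[of "g' z" C "b - x"]
      by (simp add: mult.commute)
  qed
  have "isCont (\<lambda>x. 1 / g x) x" if "a < x" "x < b" for x
    using that g[of x] neg[of x] by (intro isCont_divide) (auto intro: DERIV_isCont)
  then obtain \<Theta> where \<Theta>: "\<And>x. a < x \<Longrightarrow> x < b \<Longrightarrow> (\<Theta> has_real_derivative 1 / g x) (at x)"
    using einterval_antiderivative[of "ereal a" "ereal b" "\<lambda>x. 1 / g x"] assms(1)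
    by (auto simp: has_real_derivative_iff_has_vector_derivative)
  have anti: "\<Theta> y < \<Theta> x" if xy: "a < x" "x < y" "y < b" for x y
  proof (rule DERIV_neg_imp_decreasing[OF xy(2)])
    fix z assume "x \<le> z" "z \<le> y"
    with xy have z: "a < z" "z < b" by auto
    with neg[OF z] \<Theta>[OF z] show "\<exists>w. (\<Theta> has_real_derivative w) (at z) \<and> w < 0"
      by (intro exI[of _ "1 / g z"]) simp
  qed
  define c where "c = (a + b) / 2"
  have c: "a < c" "c < b" using assms(1) by (auto simp: c_def)
  \<comment> \<open>The bound \<open>- g x \<le> C * (x - a)\<close> makes
    \<open>\<Theta> x + ln (x - a) / C\<close> nonincreasing, so \<open>\<Theta>\<close> grows at
    least logarithmically near \<open>a\<close>.\<close>
  have near_a: "\<Theta> c + (ln (c - a) - ln (x - a)) / C \<le> \<Theta> x" if "a < x" "x \<le> c" for x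
  proof -
    have "\<Theta> c + ln (c - a) / C \<le> \<Theta> x + ln (x - a) / C"
    proof (rule DERIV_nonpos_imp_nonincreasing[OF that(2)])
      fix z assume z: "x \<le> z" "z \<le> c"
      have "1 / g z + 1 / (C * (z - a)) \<le> 0"
        using lip_a[of z] neg[of z] z that c C(1)
          frac_le[of 1 1 "- g z" "C * (z - a)"] by simp
      moreover have "((\<lambda>x. \<Theta> x + ln (x - a) / C) has_real_derivative 1 / g z + 1 / (C * (z - a))) (at z)"
        using z that c C(1) by (auto intro!: derivative_eq_intros \<Theta>)
      ultimately show "\<exists>y. ((\<lambda>x. \<Theta> x + ln (x - a) / C) has_real_derivative y) (at z) \<and> y \<le> 0"
        by blast
    qed
    then show ?thesis by (simp add: diff_divide_distrib)
  qed
  have near_b: "\<Theta> x \<le> \<Theta> c + (ln (b - x) - ln (b - c)) / C" if "c \<le> x" "x < b" for x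
  proof -
    have "\<Theta> x - ln (b - x) / C \<le> \<Theta> c - ln (b - c) / C"
    proof (rule DERIV_nonpos_imp_nonincreasing[OF that(1)])
      fix z assume z: "c \<le> z" "z \<le> x"
      have "1 / g z + 1 / (C * (b - z)) \<le> 0"
        using lip_b[of z] neg[of z] z that c C(1)
          frac_le[of 1 1 "- g z" "C * (b - z)"] by simp
      moreover have "((\<lambda>x. \<Theta> x - ln (b - x) / C) has_real_derivative 1 / g z + 1 / (C * (b - z))) (at z)"
        using z that c C(1) by (auto intro!: derivative_eq_intros \<Theta>)
      ultimately show "\<exists>y. ((\<lambda>x. \<Theta> x - ln (b - x) / C) has_real_derivative y) (at z) \<and> y \<le> 0"
        by blast
    qed
    then show ?thesis by (simp add: diff_divide_distrib)
  qed
  have surj: "\<exists>x. a < x \<and> x < b \<and> \<Theta> x = t" for t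
  proof -
    \<comment> \<open>Moving from \<open>c\<close> towards either end until the remaining distance
      has shrunk by the factor \<open>r\<close> shifts the logarithmic bounds by exactly
      \<open>\<bar>t - \<Theta> c\<bar>\<close>, hence
      \<open>\<Theta> x2 \<le> t \<le> \<Theta> x1\<close>.\<close>
    define r where "r = exp (- (C * \<bar>t - \<Theta> c\<bar>))"
    have r: "0 < r" "r \<le> 1" "ln r = - (C * \<bar>t - \<Theta> c\<bar>)" using C(1) by (auto simp: r_def)
    define x1 where "x1 = a + (c - a) * r"
    define x2 where "x2 = b - (b - c) * r"
    have "0 < (c - a) * r" "(c - a) * r \<le> c - a" "0 < (b - c) * r" "(b - c) * r \<le> b - c"
      using c r by (simp_all add: mult_left_le)
    then have x1: "a < x1" "x1 \<le> c" and x2: "c \<le> x2" "x2 < b"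
      unfolding x1_def x2_def by linarith+
    have "ln (x1 - a) = ln (c - a) + ln r" using c r by (simp add: x1_def ln_mult)
    then have "(ln (c - a) - ln (x1 - a)) / C = \<bar>t - \<Theta> c\<bar>" using r C(1) by simp
    then have "t \<le> \<Theta> x1" using near_a[OF x1] by linarith
    moreover have "ln (b - x2) = ln (b - c) + ln r" using c r by (simp add: x2_def ln_mult)
    then have "(ln (b - x2) - ln (b - c)) / C = - \<bar>t - \<Theta> c\<bar>" using r C(1) by simp
    then have "\<Theta> x2 \<le> t" using near_b[OF x2] by linarith
    moreover have "isCont \<Theta> x" if "x1 \<le> x" "x \<le> x2" for x
      using that x1 x2 by (intro DERIV_isCont[OF \<Theta>]) auto
    ultimately obtain x where "x1 \<le> x" "x \<le> x2" "\<Theta> x = t"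
      using IVT2[of \<Theta> x2 t x1] x1 x2 by auto
    with x1 x2 show ?thesis by (intro exI[of _ x]) auto
  qed
  have inj: "inj_on \<Theta> {a<..<b}"
  proof (rule inj_onI)
    fix x y assume "x \<in> {a<..<b}" "y \<in> {a<..<b}" "\<Theta> x = \<Theta> y"
    then show "x = y" using anti[of x y] anti[of y x] by (cases x y rule: linorder_cases) auto
  qed
  define X where "X = inv_into {a<..<b} \<Theta>"
  have im: "t \<in> \<Theta> ` {a<..<b}" for t using surj[of t] by auto
  have X: "a < X t" "X t < b" "\<Theta> (X t) = t" for t
    using inv_into_into[OF im[of t]] f_inv_into_f[OF im[of t]] by (auto simp: X_def)
  have X\<Theta>: "X (\<Theta> x) = x" if "a < x" "x < b" for x
    using that inj by (simp add: X_def)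
  have "(X has_real_derivative g (X t)) (at t)" for t
  proof -
    \<comment> \<open>\<open>\<Theta>\<close> has slope \<open>1 / g\<close> at \<open>X t\<close>,
      so its inverse has the reciprocal slope, which is the differential equation.\<close>
    have "(X has_derivative (*) (g (X t))) (at (\<Theta> (X t)))"
    proof (rule has_derivative_inverse_strong[of "{a<..<b}" "X t" \<Theta> X "(*) (1 / g (X t))"])
      show "continuous_on {a<..<b} \<Theta>"
        by (intro continuous_at_imp_continuous_on ballI DERIV_isCont[OF \<Theta>]) auto
      show "(\<Theta> has_derivative (*) (1 / g (X t))) (at (X t))"
        using \<Theta>[OF X(1,2)] by (simp add: has_field_derivative_def)
      show "(*) (1 / g (X t)) \<circ> (*) (g (X t)) = id"
        using neg[OF X(1,2), of t] by (auto simp: fun_eq_iff)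
    qed (use X X\<Theta> in auto)
    then show ?thesis by (simp add: has_field_derivative_def X)
  qed
  moreover have "(X \<longlongrightarrow> a) at_top"
  proof (rule order_tendstoI)
    fix u assume "u < a"
    then show "\<forall>\<^sub>F t in at_top. u < X t"
      using X(1) by (intro always_eventually) (auto intro: less_trans)
  next
    fix u assume "a < u"
    \<comment> \<open>As \<open>\<Theta>\<close> decreases, times beyond \<open>\<Theta> x\<close>
      correspond to positions below \<open>x\<close>.\<close>
    then obtain x where x: "a < x" "x < u" "x < b"
      using dense[of a "min u b"] assms(1) by auto
    show "\<forall>\<^sub>F t in at_top. X t < u"
      using eventually_gt_at_top[of "\<Theta> x"]
    proof eventually_elim
      case (elim t)
      have "\<not> x \<le> X t"
        using anti[of x "X t"] X[of t] elim x by (cases "x = X t") auto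
      with x show ?case by simp
    qed
  qed
  moreover have "(X \<longlongrightarrow> b) at_bot"
  proof (rule order_tendstoI)
    fix u assume "b < u"
    then show "\<forall>\<^sub>F t in at_bot. X t < u"
      using X(2) by (intro always_eventually) (auto intro: less_trans)
  next
    fix u assume "u < b"
    then obtain x where x: "a < x" "u < x" "x < b"
      using dense[of "max u a" b] assms(1) by auto
    show "\<forall>\<^sub>F t in at_bot. u < X t"
      using eventually_gt_at_bot[of "\<Theta> x"]
    proof eventually_elim
      case (elim t)
      have "\<not> X t \<le> x"
        using anti[of "X t" x] X[of t] elim x by (cases "x = X t") auto
      with x show ?case by simp
    qed
  qed
  ultimately show thesis using that X(1,2) by blast
qed

section \<open>Shock profiles for a single entropy\<close>

text \<open>\<open>E\<close> will be the total energy on a ray of entropies issued from \<open>s\<^sub>L\<close>, so \<open>D1 E\<close> is minus the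
  pressure, and \<open>x0\<close> and \<open>0\<close> are the specific volume and the ray parameter of the left state.\<close>

locale scalar_shock =
  fixes E :: "real \<Rightarrow> real \<Rightarrow> real" and x0 m :: real
  assumes smooth_E: "smooth2 E"
    and x0_pos: "0 < x0"
    and D2_E_pos: "\<And>x y. 0 < x \<Longrightarrow> 0 < D2 E x y"
    and D1_E_antimono: "\<And>x y y'. 0 < x \<Longrightarrow> y < y' \<Longrightarrow> D1 E x y' < D1 E x y"
    and D1_D1_D1_E_neg: "\<And>x y. 0 < x \<Longrightarrow> D1 (D1 (D1 E)) x y < 0"
    and lax: "D1 (D1 E) x0 0 < m\<^sup>2"
    and E_at_0: "LIM x at_right 0. E x 0 :> at_top"
    and E_at_top: "\<And>x. 0 < x \<Longrightarrow> LIM y at_top. E x y :> at_top"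
begin

section \<open>The jump functions on a ray and their derivatives\<close>

definition F :: "real \<Rightarrow> real \<Rightarrow> real" where
  "F x y = D1 E x0 0 - D1 E x y + m\<^sup>2 * (x - x0)"

definition H :: "real \<Rightarrow> real \<Rightarrow> real" where
  "H x y = E x y - E x0 0 - m\<^sup>2 / 2 * (x\<^sup>2 - x0\<^sup>2) + (m\<^sup>2 * x0 - D1 E x0 0) * (x - x0)"

lemma F_x0 [simp]: "F x0 0 = 0" and H_x0 [simp]: "H x0 0 = 0"
  by (auto simp: F_def H_def)

lemma F_chain:
  assumes "0 < X t" "(X has_real_derivative X') (at t)" "(Y has_real_derivative Y') (at t)"
  shows "((\<lambda>t. F (X t) (Y t)) has_real_derivative
    (m\<^sup>2 - D1 (D1 E) (X t) (Y t)) * X' - D2 (D1 E) (X t) (Y t) * Y') (at t)"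
  unfolding F_def
  by (rule derivative_eq_intros refl smooth2_chain[OF smooth2_D1[OF smooth_E]] assms)+
     (simp add: algebra_simps)

text \<open>The partial derivative of \<open>H\<close> in \<open>x\<close> is \<open>- F\<close>;
  this identity makes \<open>H\<close> a first integral of the profile equations.\<close>

lemma H_chain:
  assumes "0 < X t" "(X has_real_derivative X') (at t)" "(Y has_real_derivative Y') (at t)"
  shows "((\<lambda>t. H (X t) (Y t)) has_real_derivative
    D2 E (X t) (Y t) * Y' - F (X t) (Y t) * X') (at t)"
  unfolding H_def
  by (rule derivative_eq_intros refl smooth2_chain[OF smooth_E] assms)+
     (simp add: F_def algebra_simps power2_eq_square)

lemma F_D1: "0 < x \<Longrightarrow> ((\<lambda>x. F x y) has_real_derivative m\<^sup>2 - D1 (D1 E) x y) (at x)"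
  using F_chain[of "\<lambda>t. t" x 1 "\<lambda>t. y" 0] by simp

lemma H_D1: "0 < x \<Longrightarrow> ((\<lambda>x. H x y) has_real_derivative - F x y) (at x)"
  using H_chain[of "\<lambda>t. t" x 1 "\<lambda>t. y" 0] by simp

lemma H_D2: "0 < x \<Longrightarrow> ((\<lambda>y. H x y) has_real_derivative D2 E x y) (at y)"
  using H_chain[of "\<lambda>t. x" y 0 "\<lambda>t. t" 1] by simp

section \<open>Monotonicity, convexity and uniqueness of common zeros\<close>

lemma F_strict_mono2: "0 < x \<Longrightarrow> y < y' \<Longrightarrow> F x y < F x y'"
  using D1_E_antimono[of x y y'] by (simp add: F_def)

lemma H_strict_mono2: "0 < x \<Longrightarrow> y < y' \<Longrightarrow> H x y < H x y'"
  using DERIV_pos_imp_increasing[of y y' "\<lambda>y. H x y"] H_D2 D2_E_pos by blast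

lemma H_inj2: "0 < x \<Longrightarrow> H x y = H x y' \<Longrightarrow> y = y'"
  using H_strict_mono2[of x y y'] H_strict_mono2[of x y' y] by (cases y y' rule: linorder_cases) auto

text \<open>The second derivative of \<open>F\<close> in \<open>x\<close> is
  \<open>- D1 (D1 (D1 E))\<close>, which is positive by convexity of the pressure.\<close>

lemma dF_strict_mono1:
  assumes "0 < x" "x < x'"
  shows "m\<^sup>2 - D1 (D1 E) x y < m\<^sup>2 - D1 (D1 E) x' y"
proof -
  have "D1 (D1 E) x' y < D1 (D1 E) x y"
  proof (rule DERIV_neg_imp_decreasing[OF assms(2)])
    fix z assume "x \<le> z" "z \<le> x'"
    then have "0 < z" using assms by auto
    then show "\<exists>w. ((\<lambda>a. D1 (D1 E) a y) has_real_derivative w) (at z) \<and> w < 0"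
      using smooth2_D1_works[OF smooth2_D1[OF smooth2_D1[OF smooth_E]]] D1_D1_D1_E_neg by blast
  qed
  then show ?thesis by simp
qed

text \<open>Both chord slopes are values of the strictly increasing derivative, at points on either
  side of \<open>y\<close>.\<close>

lemma F_convex:
  assumes "0 < x" "x < y" "y < z"
  shows "(F y r - F x r) / (y - x) < (F z r - F y r) / (z - y)"
proof -
  let ?D = "\<lambda>t. m\<^sup>2 - D1 (D1 E) t r"
  obtain s where s: "x < s" "s < y" "F y r - F x r = (y - x) * ?D s"
    using MVT2[of x y "\<lambda>t. F t r" ?D] F_D1 assms by auto
  obtain t where t: "y < t" "t < z" "F z r - F y r = (z - y) * ?D t"
    using MVT2[of y z "\<lambda>t. F t r" ?D] F_D1 assms by auto
  have "?D s < ?D t" using dF_strict_mono1[of s t] s t assms by simp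
  moreover have "(F y r - F x r) / (y - x) = ?D s" using s assms by simp
  moreover have "(F z r - F y r) / (z - y) = ?D t" using t assms by simp
  ultimately show ?thesis by simp
qed

text \<open>A nonnegative chord slope on \<open>x\<close>, \<open>y\<close> forces a positive one on
  \<open>y\<close>, \<open>z\<close>.\<close>

lemma F_pos_right:
  assumes "0 < x" "x < y" "y < z" "F x r \<le> 0" "F y r \<ge> 0"
  shows "0 < F z r"
proof -
  have "0 \<le> (F y r - F x r) / (y - x)" using assms by simp
  also note F_convex[OF assms(1-3), of r]
  finally show ?thesis using assms by (simp add: zero_less_divide_iff)
qed

lemma F_neg_between:
  assumes "0 < x" "x < y" "y < z" "F x r \<le> 0" "F z r \<le> 0"
  shows "F y r < 0"
  using F_pos_right[OF assms(1-4)] assms(5) by force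

text \<open>Mean value theorem with slope \<open>- F\<close>.\<close>

lemma H_mono_between:
  assumes "0 < x" "x < z" "\<And>y. x < y \<Longrightarrow> y < z \<Longrightarrow> F y r < 0"
  shows "H x r < H z r"
proof -
  obtain s where s: "x < s" "s < z" "H z r - H x r = - ((z - x) * F s r)"
    using MVT2[of x z "\<lambda>t. H t r" "\<lambda>t. - F t r"] H_D1 assms by auto
  then have "(z - x) * F s r < 0" using assms(2,3) by (intro mult_pos_neg) auto
  with s(3) show ?thesis by linarith
qed

lemma H_antimono_between:
  assumes "0 < x" "x < z" "\<And>y. x < y \<Longrightarrow> y < z \<Longrightarrow> 0 < F y r"
  shows "H z r < H x r"
proof -
  obtain s where s: "x < s" "s < z" "H z r - H x r = - ((z - x) * F s r)"
    using MVT2[of x z "\<lambda>t. H t r" "\<lambda>t. - F t r"] H_D1 assms by auto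
  then have "0 < (z - x) * F s r" using assms(2,3) by (intro mult_pos_pos) auto
  with s(3) show ?thesis by linarith
qed

text \<open>At \<open>(x', y)\<close> both functions are negative, since both increase with the
  level. If \<open>x'\<close> lay to the right of \<open>x\<close>, convexity would make
  \<open>F\<close> negative in between, so \<open>H\<close> would rise from 0 and be positive at
  \<open>x'\<close>.\<close>

lemma zeros_antimono:
  assumes "0 < x" "F x y = 0" "H x y = 0" "0 < x'" "F x' y' = 0" "H x' y' = 0" "y < y'"
  shows "x' < x"
proof (rule ccontr)
  assume "\<not> x' < x"
  have neg: "F x' y < 0" "H x' y < 0"
    using F_strict_mono2[of x' y y'] H_strict_mono2[of x' y y'] assms by auto
  with assms \<open>\<not> x' < x\<close> have "x < x'" by (cases "x = x'") auto
  then have "H x y < H x' y"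
    using F_neg_between[of x _ x' y] assms neg by (intro H_mono_between) auto
  with neg assms show False by simp
qed

text \<open>If \<open>0 < y < y'\<close>, then \<open>x\<close> would be the larger zero of \<open>F\<close> at level \<open>y\<close>, where \<open>H\<close> is
  positive since it already is at \<open>x0\<close>.\<close>

lemma zeros_unique:
  assumes "0 < x" "F x y = 0" "H x y = 0" "0 < x'" "F x' y' = 0" "H x' y' = 0" "0 < y" "0 < y'"
  shows "y = y'"
proof -
  have False if A: "0 < x" "F x y = 0" "H x y = 0" "0 < x'" "F x' y' = 0" "H x' y' = 0"
    "0 < y" "y < y'" for x y x' y'
  proof -
    have "x' < x" using zeros_antimono[OF A(1-6,8)] .
    moreover have "x < x0" using zeros_antimono[of x0 0 x y] A x0_pos by simp
    moreover have "F x' y < 0" using F_strict_mono2[of x' y y'] A by simp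
    ultimately have "H x0 y < H x y"
      using A F_pos_right[of x' x _ y] by (intro H_antimono_between) auto
    moreover have "H x0 0 < H x0 y" using H_strict_mono2 x0_pos A by blast
    ultimately show False using A by simp
  qed
  then show ?thesis using assms by (cases y y' rule: linorder_cases) blast+
qed

section \<open>The curve \<open>H = 0\<close> as a graph over the specific volume\<close>

lemma H_has_derivative:
  assumes "0 < x"
  shows "((\<lambda>(x, y). H x y) has_derivative (\<lambda>(h, k). D2 E x y * k - F x y * h)) (at (x, y))"
proof -
  have "((\<lambda>z. H (fst z) (snd z)) has_derivative
      (\<lambda>z. D1 E x y * fst z + D2 E x y * snd z - m\<^sup>2 / 2 * (2 * x * fst z)
        + (m\<^sup>2 * x0 - D1 E x0 0) * fst z)) (at (x, y))"
    unfolding H_def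
    by (rule derivative_eq_intros refl smooth2_has_derivative[OF smooth_E assms, unfolded case_prod_unfold])+
       (auto simp: algebra_simps)
  moreover have "(\<lambda>z. D1 E x y * fst z + D2 E x y * snd z - m\<^sup>2 / 2 * (2 * x * fst z)
        + (m\<^sup>2 * x0 - D1 E x0 0) * fst z) = (\<lambda>(h, k). D2 E x y * k - F x y * h)"
    by (auto simp: F_def algebra_simps)
  ultimately show ?thesis by (simp add: case_prod_unfold)
qed

text \<open>Straightens the level curves of \<open>H\<close>: a preimage of \<open>(x, 0)\<close> is
  a point of the curve \<open>H = 0\<close> above \<open>x\<close>.\<close>

definition graph_map :: "real \<times> real \<Rightarrow> real \<times> real" where
  "graph_map = (\<lambda>(x, y). (x, H x y))"

text \<open>The zero of \<open>H x\<close> (junk where there is none). As a component of an inverse map, it can be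
  differentiated by the inverse function theorem.\<close>

definition \<phi> :: "real \<Rightarrow> real" where
  "\<phi> x = snd (inv_into ({0<..} \<times> UNIV) graph_map (x, 0))"

lemma inj_graph_map: "inj_on graph_map ({0<..} \<times> UNIV)"
  by (rule inj_onI) (auto simp: graph_map_def intro: H_inj2)

lemma \<phi>_eqI:
  assumes "0 < x" "H x y = 0"
  shows "\<phi> x = y"
proof -
  have "inv_into ({0<..} \<times> UNIV) graph_map (graph_map (x, y)) = (x, y)"
    using assms by (intro inv_into_f_f[OF inj_graph_map]) auto
  then show ?thesis using assms by (simp add: \<phi>_def graph_map_def)
qed

text \<open>The slope of the curve \<open>H = 0\<close> by implicit differentiation, and also the
  velocity of the profile when \<open>D2 E\<close> is the total viscosity.\<close>

definition G :: "real \<Rightarrow> real \<Rightarrow> real" where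
  "G x y = F x y / D2 E x y"

text \<open>The derivative of \<open>graph_map\<close> is triangular with diagonal entries 1 and
  \<open>D2 E\<close>, hence invertible; the slope is read off from the inverse in direction
  \<open>(1, 0)\<close>.\<close>

lemma \<phi>_deriv:
  assumes "0 < x" "H x y = 0"
  shows "(\<phi> has_real_derivative G x y) (at x)"
proof -
  let ?S = "{0<..} \<times> UNIV :: (real \<times> real) set"
  have graph_der: "(graph_map has_derivative (\<lambda>(h, k). (h, D2 E a b * k - F a b * h))) (at (a, b))"
    if "0 < a" for a b
    using has_derivative_Pair[OF has_derivative_fst[OF has_derivative_ident] H_has_derivative[OF that]]
    by (simp add: graph_map_def case_prod_unfold)
  have "(inv_into ?S graph_map has_derivative (\<lambda>(h, k). (h, (k + F x y * h) / D2 E x y)))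
      (at (graph_map (x, y)))"
  proof (rule has_derivative_inverse_strong[OF open_halfplane _ _ _ graph_der])
    show "continuous_on ?S graph_map"
      using graph_der by (intro continuous_at_imp_continuous_on) (auto intro!: has_derivative_continuous)
    show "(\<lambda>(h, k). (h, D2 E x y * k - F x y * h)) \<circ> (\<lambda>(h, k). (h, (k + F x y * h) / D2 E x y)) = id"
      using D2_E_pos[OF assms(1), of y] by (auto simp: fun_eq_iff)
  qed (use assms inj_graph_map in auto)
  then have inv: "(inv_into ?S graph_map has_derivative (\<lambda>(h, k). (h, (k + F x y * h) / D2 E x y))) (at (x, 0))"
    using assms by (simp add: graph_map_def)
  have "((\<lambda>t. (t, 0::real)) has_derivative (\<lambda>h. (h, 0))) (at x)"
    by (rule has_derivative_Pair) auto
  from has_derivative_snd[OF has_derivative_compose[OF this inv]]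
  have "(\<phi> has_derivative (\<lambda>h. F x y * h / D2 E x y)) (at x)"
    by (simp add: \<phi>_def[abs_def])
  moreover have "(\<lambda>h. F x y * h / D2 E x y) = (*) (G x y)"
    by (simp add: G_def fun_eq_iff)
  ultimately show ?thesis by (simp add: has_field_derivative_def)
qed

text \<open>In \<open>y\<close>, \<open>H\<close> differs from \<open>E\<close> by a constant, so it
  grows to infinity and the intermediate value theorem applies.\<close>

lemma H_zero_exists:
  assumes "0 < x" "H x 0 \<le> 0"
  shows "\<exists>y\<ge>0. H x y = 0"
proof -
  define K where "K = E x 0 - H x 0"
  have K: "H x y = E x y - K" for y by (simp add: H_def K_def)
  have "\<forall>\<^sub>F y in at_top. K \<le> E x y"
    using E_at_top[OF assms(1)] by (simp add: filterlim_at_top)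
  then obtain y where "0 \<le> y" "0 \<le> H x y"
    using eventually_happens[OF eventually_conj[OF _ eventually_ge_at_top[of 0]]] K by force
  then show ?thesis
    using IVT[of "\<lambda>y. H x y" 0 0 y] assms DERIV_isCont[OF H_D2] by blast
qed

text \<open>By the Lax condition \<open>F\<close> increases through 0 at \<open>x0\<close>, so
  \<open>H\<close> is negative just to the left. The blow-up of the energy at vanishing volume makes
  \<open>H\<close> nonnegative further left, and \<open>x1\<close> is the last zero before
  \<open>x0\<close>.\<close>

lemma left_end:
  obtains x1 where "0 < x1" "x1 < x0" "H x1 0 = 0" "\<forall>x\<in>{x1<..<x0}. H x 0 < 0"
proof -
  obtain d where d: "0 < d" "\<And>h. 0 < h \<Longrightarrow> h < d \<Longrightarrow> F (x0 - h) 0 < 0"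
    using DERIV_pos_inc_left[OF F_D1[OF x0_pos, of 0]] lax by auto
  define b where "b = x0 - min d x0 / 2"
  have b: "0 < b" "b < x0" using d x0_pos by (auto simp: b_def min_def)
  have neg: "H x 0 < 0" if "b \<le> x" "x < x0" for x
  proof -
    have "F y 0 < 0" if "x < y" "y < x0" for y
      using d(2)[of "x0 - y"] d(1) that \<open>b \<le> x\<close> x0_pos by (auto simp: b_def min_def split: if_splits)
    then show ?thesis using H_mono_between[of x x0 0] that b by simp
  qed
  \<comment> \<open>Collects the terms of \<open>H\<close> other than \<open>E x 0\<close>: for
    \<open>x < x0\<close> the quadratic one contributes nonnegatively and the linear one is
    bounded.\<close>
  define K where "K = E x0 0 + \<bar>m\<^sup>2 * x0 - D1 E x0 0\<bar> * x0"
  have HK: "E x 0 - K \<le> H x 0" if "0 < x" "x < x0" for x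
  proof -
    have "x\<^sup>2 \<le> x0\<^sup>2" using that by (intro power_mono) auto
    then have "m\<^sup>2 / 2 * (x\<^sup>2 - x0\<^sup>2) \<le> 0" by (intro mult_nonneg_nonpos) auto
    moreover have "\<bar>(m\<^sup>2 * x0 - D1 E x0 0) * (x - x0)\<bar> \<le> \<bar>m\<^sup>2 * x0 - D1 E x0 0\<bar> * x0"
      unfolding abs_mult using that by (intro mult_left_mono) auto
    ultimately show ?thesis unfolding H_def K_def by linarith
  qed
  have "\<forall>\<^sub>F x in at_right 0. K \<le> E x 0"
    using E_at_0 by (simp add: filterlim_at_top)
  moreover have "\<forall>\<^sub>F x in at_right 0. x \<in> {0<..<b}"
    using b(1) by (rule eventually_at_right_real)
  ultimately have "\<forall>\<^sub>F x in at_right 0. K \<le> E x 0 \<and> x \<in> {0<..<b}"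
    by (rule eventually_conj)
  then obtain c where c': "K \<le> E c 0" "c \<in> {0<..<b}"
    using eventually_happens trivial_limit_at_right_real by blast
  then have c: "0 < c" "c < b" "0 \<le> H c 0" using HK[of c] b by auto
  have cont: "isCont (\<lambda>x. H x 0) x" if "0 < x" for x
    using DERIV_isCont[OF H_D1[OF that]] .
  have zero: "\<exists>z\<ge>x. z \<le> b \<and> H z 0 = 0" if "0 < x" "x \<le> b" "0 \<le> H x 0" for x
    using IVT2[of "\<lambda>x. H x 0" b 0 x] that cont neg[of b] b by force
  \<comment> \<open>The zeros in \<open>{c..b}\<close> form a nonempty compact set, so a largest one
    exists; a nonnegative value to its right would yield a larger zero.\<close>
  define Z where "Z = {x \<in> {c..b}. H x 0 = 0}"
  have "continuous_on {c..b} (\<lambda>x. H x 0)"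
    using cont c by (intro continuous_at_imp_continuous_on) auto
  then have "closed Z"
    unfolding Z_def by (rule continuous_closed_preimage_constant) simp
  moreover have "bounded Z"
    by (rule bounded_subset[of "{c..b}"]) (auto simp: Z_def)
  ultimately have "compact Z" by (simp add: compact_eq_bounded_closed)
  moreover have "Z \<noteq> {}" using zero[of c] c by (auto simp: Z_def)
  ultimately obtain x1 where x1: "x1 \<in> Z" "\<forall>x\<in>Z. x \<le> x1"
    using compact_attains_sup[of Z] by blast
  then have x1': "c \<le> x1" "x1 \<le> b" "H x1 0 = 0" by (auto simp: Z_def)
  show thesis
  proof (rule that[of x1], safe)
    fix x assume x: "x \<in> {x1<..<x0}"
    show "H x 0 < 0"
    proof (cases "b \<le> x")
      case False
      show ?thesis
      proof (rule ccontr)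
        assume "\<not> H x 0 < 0"
        then obtain z where "x \<le> z" "z \<le> b" "H z 0 = 0"
          using zero[of x] False x x1' c by auto
        then have "z \<in> Z" using x x1' by (auto simp: Z_def)
        then show False using bspec[OF x1(2), of z] x \<open>x \<le> z\<close> by simp
      qed
    qed (use neg x in auto)
  qed (use x1' c b in auto)
qed

text \<open>The derivative of \<open>G\<close> at \<open>(x, y)\<close> in direction
  \<open>(h, k)\<close>, by the quotient rule.\<close>

definition dG :: "real \<Rightarrow> real \<Rightarrow> real \<Rightarrow> real \<Rightarrow> real" where
  "dG x y h k = (((m\<^sup>2 - D1 (D1 E) x y) * h - D2 (D1 E) x y * k) * D2 E x y
     - F x y * (D1 (D2 E) x y * h + D2 (D2 E) x y * k)) / (D2 E x y * D2 E x y)"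

lemma G_chain:
  assumes "0 < X t" "(X has_real_derivative X') (at t)" "(Y has_real_derivative Y') (at t)"
  shows "((\<lambda>t. G (X t) (Y t)) has_real_derivative dG (X t) (Y t) X' Y') (at t)"
  unfolding G_def dG_def
  using D2_E_pos[OF assms(1), of "Y t"]
  by (intro DERIV_divide F_chain smooth2_chain[OF smooth2_D2[OF smooth_E]] assms) simp

lemma continuous_on_G:
  assumes "continuous_on A X" "continuous_on A Y" "\<And>t. t \<in> A \<Longrightarrow> 0 < X t"
  shows "continuous_on A (\<lambda>t. G (X t) (Y t))"
proof -
  note c = smooth2_continuous_on[OF _ assms]
  have "\<forall>t\<in>A. D2 E (X t) (Y t) \<noteq> 0" using D2_E_pos assms(3) by (metis less_irrefl)
  then show ?thesis
    unfolding G_def F_def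
    by (intro continuous_on_divide continuous_on_add continuous_on_diff continuous_on_mult
          continuous_on_const assms(1) c[OF smooth2_D1[OF smooth_E]] c[OF smooth2_D2[OF smooth_E]])
qed

lemma continuous_on_dG:
  assumes "continuous_on A X" "continuous_on A Y" "\<And>t. t \<in> A \<Longrightarrow> 0 < X t"
    and "continuous_on A h" "continuous_on A k"
  shows "continuous_on A (\<lambda>t. dG (X t) (Y t) (h t) (k t))"
proof -
  note c = smooth2_continuous_on[OF _ assms(1-3)]
  have "\<forall>t\<in>A. D2 E (X t) (Y t) * D2 E (X t) (Y t) \<noteq> 0"
    using D2_E_pos assms(3) by (metis less_irrefl mult_eq_0_iff)
  then show ?thesis
    unfolding dG_def F_def
    by (intro continuous_on_divide continuous_on_add continuous_on_diff continuous_on_mult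
          continuous_on_const assms c[OF smooth2_D1[OF smooth_E]] c[OF smooth2_D2[OF smooth_E]]
          c[OF smooth2_D1[OF smooth2_D1[OF smooth_E]]] c[OF smooth2_D2[OF smooth2_D1[OF smooth_E]]]
          c[OF smooth2_D1[OF smooth2_D2[OF smooth_E]]] c[OF smooth2_D2[OF smooth2_D2[OF smooth_E]]])
qed

section \<open>The orbit along the graph\<close>

proposition profile_exists:
  obtains L xR X Y where "0 < L" "0 < xR" "F xR L = 0" "H xR L = 0"
    "\<forall>t. 0 < X t \<and> (X has_real_derivative G (X t) (Y t)) (at t) \<and>
      (Y has_real_derivative (G (X t) (Y t))\<^sup>2) (at t)"
    "(X \<longlongrightarrow> x0) at_bot" "(Y \<longlongrightarrow> 0) at_bot" "(X \<longlongrightarrow> xR) at_top" "(Y \<longlongrightarrow> L) at_top"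
proof -
  obtain x1 where x1: "0 < x1" "x1 < x0" "H x1 0 = 0" and x1': "\<forall>x\<in>{x1<..<x0}. H x 0 < 0"
    using left_end by blast
  have \<phi>: "H x (\<phi> x) = 0" "0 \<le> \<phi> x" if x: "x1 \<le> x" "x \<le> x0" for x
  proof -
    have "H x 0 \<le> 0" using x1 x bspec[OF x1', of x] by (cases "x = x1 \<or> x = x0") auto
    then obtain y where "0 \<le> y" "H x y = 0" using H_zero_exists[of x] x1 x by auto
    then show "H x (\<phi> x) = 0" "0 \<le> \<phi> x" using \<phi>_eqI[of x y] x1 x by auto
  qed
  have \<phi>_x0: "\<phi> x0 = 0" and \<phi>_x1: "\<phi> x1 = 0" using \<phi>_eqI x0_pos x1 by auto
  have \<phi>_pos: "0 < \<phi> x" if x: "x1 < x" "x < x0" for x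
    using \<phi>[of x] bspec[OF x1', of x] x by (cases "\<phi> x = 0") auto
  have \<phi>': "(\<phi> has_real_derivative G x (\<phi> x)) (at x)" if "x1 \<le> x" "x \<le> x0" for x
    using that x1 \<phi> by (intro \<phi>_deriv) auto
  have cont_\<phi>: "continuous_on {x1..x0} \<phi>"
    using DERIV_isCont[OF \<phi>'] by (intro continuous_at_imp_continuous_on) auto
  \<comment> \<open>The right state is the highest point of the graph; it is interior because
    \<open>\<phi>\<close> vanishes at both ends and is positive between them.\<close>
  obtain xR where xR: "xR \<in> {x1..x0}" "\<And>x. x \<in> {x1..x0} \<Longrightarrow> \<phi> x \<le> \<phi> xR"
    using continuous_attains_sup[OF _ _ cont_\<phi>] x1 by auto
  define L where "L = \<phi> xR"
  have L: "0 < L"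
    using \<phi>_pos[of "(x1 + x0) / 2"] xR(2)[of "(x1 + x0) / 2"] x1 by (simp add: L_def)
  then have xR': "x1 < xR" "xR < x0"
    using xR(1) \<phi>_x0 \<phi>_x1 by (auto simp: L_def less_le)
  have "G xR (\<phi> xR) = 0"
  proof (rule DERIV_local_max[OF \<phi>'])
    show "0 < min (xR - x1) (x0 - xR)" using xR' by simp
    show "\<forall>y. \<bar>xR - y\<bar> < min (xR - x1) (x0 - xR) \<longrightarrow> \<phi> y \<le> \<phi> xR"
      using xR(2) by (auto simp: abs_less_iff)
  qed (use xR' in auto)
  then have FR: "F xR L = 0" using D2_E_pos[of xR L] xR' x1 by (simp add: G_def L_def)
  have HR: "H xR L = 0" using \<phi>[of xR] xR' by (simp add: L_def)
  define g where "g = (\<lambda>x. G x (\<phi> x))"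
  have cont_g: "continuous_on {xR..x0} g"
    unfolding g_def using xR' x1
    by (intro continuous_on_G continuous_intros continuous_on_subset[OF cont_\<phi>]) auto
  have g: "(g has_real_derivative dG x (\<phi> x) 1 (g x)) (at x)" if "xR \<le> x" "x \<le> x0" for x
    unfolding g_def using that xR' x1 by (intro G_chain \<phi>' DERIV_ident) auto
  \<comment> \<open>A further zero of \<open>g\<close> would be a common zero of \<open>F\<close>
    and \<open>H\<close> at the same level \<open>L\<close> by uniqueness; then \<open>F\<close> is
    negative between the two points and \<open>H\<close> cannot vanish at both.\<close>
  have g_nz: "g x \<noteq> 0" if x: "xR < x" "x < x0" for x
  proof
    assume "g x = 0"
    have pos: "0 < x" "0 < xR" using x xR' x1 by auto
    have F0: "F x (\<phi> x) = 0" using \<open>g x = 0\<close> D2_E_pos[OF pos(1), of "\<phi> x"] by (simp add: g_def G_def)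
    have H0: "H x (\<phi> x) = 0" and "0 < \<phi> x" using \<phi>[of x] \<phi>_pos[of x] x xR' by auto
    have eq: "\<phi> x = L"
      by (rule zeros_unique[OF pos(1) F0 H0 pos(2) FR HR \<open>0 < \<phi> x\<close> L])
    have "F y L < 0" if "xR < y" "y < x" for y
      using F_neg_between[OF pos(2) that] FR F0 eq by simp
    then have "H xR L < H x L" by (rule H_mono_between[OF pos(2) x(1)])
    then show False using HR H0 eq by simp
  qed
  \<comment> \<open>\<open>\<phi>\<close> falls from \<open>L\<close> to 0, so its slope
    \<open>g\<close> is negative somewhere; having no zero, \<open>g\<close> keeps this
    sign.\<close>
  obtain z where z: "xR < z" "z < x0" "\<phi> x0 - \<phi> xR = (x0 - xR) * g z"
  proof -
    have "(\<phi> has_real_derivative g x) (at x)" if "xR \<le> x" "x \<le> x0" for x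
      using \<phi>'[of x] that xR' by (simp add: g_def)
    from MVT2[OF xR'(2) this] show ?thesis using that by blast
  qed
  then have "(x0 - xR) * g z < 0" using L \<phi>_x0 by (simp add: L_def)
  then have gz: "g z < 0" using xR' by (simp add: mult_less_0_iff)
  have neg: "g x < 0" if x: "xR < x" "x < x0" for x
  proof (rule ccontr)
    assume "\<not> g x < 0"
    have "connected (g ` {xR<..<x0})"
      using cont_g by (intro connected_continuous_image) (auto elim: continuous_on_subset)
    then have "0 \<in> g ` {xR<..<x0}"
      using connectedD_interval[of "g ` {xR<..<x0}" "g z" "g x" 0] \<open>\<not> g x < 0\<close> gz z x by auto
    then show False using g_nz by auto
  qed
  have "continuous_on {xR..x0} (\<lambda>x. dG x (\<phi> x) 1 (g x))"
    using xR' x1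
    by (intro continuous_on_dG continuous_intros cont_g continuous_on_subset[OF cont_\<phi>]) auto
  moreover have "g xR = 0" "g x0 = 0" using FR by (auto simp: g_def G_def \<phi>_x0 L_def)
  ultimately obtain X where X': "\<forall>t. xR < X t \<and> X t < x0 \<and> (X has_real_derivative g (X t)) (at t)"
    and X_lim: "(X \<longlongrightarrow> x0) at_bot" "(X \<longlongrightarrow> xR) at_top"
    using decreasing_heteroclinic_orbit[OF xR'(2) g _ _ _ neg] by blast
  then have X: "xR < X t" "X t < x0" "(X has_real_derivative g (X t)) (at t)" for t
    by auto
  \<comment> \<open>The slope of the graph equals the velocity along it, so the height moves with
    the square of \<open>g\<close>.\<close>
  have \<phi>X': "((\<lambda>t. \<phi> (X t)) has_real_derivative (g (X t))\<^sup>2) (at t)" for t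
    using DERIV_chain2[OF \<phi>' X(3), of t] X(1,2)[of t] xR' by (simp add: g_def power2_eq_square)
  have pos: "0 < xR" "0 < X t" for t using X(1)[of t] xR' x1 by auto
  show thesis
  proof (rule that[of L xR X "\<lambda>t. \<phi> (X t)"])
    show "\<forall>t. 0 < X t \<and> (X has_real_derivative G (X t) (\<phi> (X t))) (at t) \<and>
        ((\<lambda>t. \<phi> (X t)) has_real_derivative (G (X t) (\<phi> (X t)))\<^sup>2) (at t)"
      using X(3) \<phi>X' pos by (simp add: g_def)
    show "((\<lambda>t. \<phi> (X t)) \<longlongrightarrow> 0) at_bot"
      using isCont_tendsto_compose[OF DERIV_isCont[OF \<phi>'] X_lim(1)] x1 \<phi>_x0 by simp
    show "((\<lambda>t. \<phi> (X t)) \<longlongrightarrow> L) at_top"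
      using isCont_tendsto_compose[OF DERIV_isCont[OF \<phi>'] X_lim(2)] xR' by (simp add: L_def)
  qed (use L FR HR X_lim pos in auto)
qed

end

section \<open>Plane waves of the Navier-Stokes system\<close>

lemma pres_eq: "pres e i x r = - D1 (e i) x r" and temp_eq: "temp e i x r = D2 (e i) x r"
  by (simp_all add: pres_def D1_def temp_def D2_def)

text \<open>Existence is enough: the derivative of the pressure cancels in the momentum
  equation.\<close>

lemma total_pres_chain:
  fixes e :: "'n::finite \<Rightarrow> real \<Rightarrow> real \<Rightarrow> real"
  assumes "\<And>i. smooth2 (e i)" "0 < X t" "(X has_real_derivative X') (at t)"
    and "\<And>i. ((\<lambda>t. S t $ i) has_real_derivative S' i) (at t)"
  shows "\<exists>P'. ((\<lambda>t. total_pres e (X t) (S t)) has_real_derivative P') (at t)"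
proof -
  have "((\<lambda>t. - D1 (e i) (X t) (S t $ i)) has_real_derivative
      - (D1 (D1 (e i)) (X t) (S t $ i) * X' + D2 (D1 (e i)) (X t) (S t $ i) * S' i)) (at t)" for i
    by (intro DERIV_minus smooth2_chain smooth2_D1 assms)
  then have "((\<lambda>t. \<Sum>i\<in>UNIV. - D1 (e i) (X t) (S t $ i)) has_real_derivative
      (\<Sum>i\<in>UNIV. - (D1 (D1 (e i)) (X t) (S t $ i) * X' + D2 (D1 (e i)) (X t) (S t $ i) * S' i))) (at t)"
    by (rule DERIV_sum)
  then show ?thesis unfolding total_pres_def pres_eq by blast
qed

lemma Dt_plane_wave:
  assumes "(w has_real_derivative w') (at ((x - \<sigma> * t) / c))"
  shows "Dt (\<lambda>t x. w ((x - \<sigma> * t) / c)) t x = - (\<sigma> * w') / c"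
proof -
  have "((\<lambda>t. w ((x - \<sigma> * t) / c)) has_real_derivative w' * (- \<sigma> / c)) (at t)"
    by (rule DERIV_chain2[where f = w and g = "\<lambda>t. (x - \<sigma> * t) / c", OF assms], rule DERIV_cdivide)
       (auto intro!: derivative_eq_intros)
  then show ?thesis by (simp add: Dt_def DERIV_imp_deriv mult.commute)
qed

lemma Dx_plane_wave:
  assumes "(w has_real_derivative w') (at ((x - \<sigma> * t) / c))"
  shows "Dx (\<lambda>t x. w ((x - \<sigma> * t) / c)) t x = w' / c"
proof -
  have "((\<lambda>x. w ((x - \<sigma> * t) / c)) has_real_derivative w' * (1 / c)) (at x)"
    by (rule DERIV_chain2[where f = w and g = "\<lambda>x. (x - \<sigma> * t) / c", OF assms], rule DERIV_cdivide)
       (auto intro!: derivative_eq_intros)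
  then show ?thesis by (simp add: Dx_def DERIV_imp_deriv)
qed

lemma plane_wave_bounded_linear:
  "bounded_linear (\<lambda>z :: real \<times> real. (snd z - \<sigma> * fst z) / c)"
  by (intro bounded_linear_compose[OF bounded_linear_divide] bounded_linear_sub bounded_linear_snd
      bounded_linear_compose[OF bounded_linear_mult_right bounded_linear_fst])

text \<open>All fields depend on \<open>z = (x - \<sigma> * t) / (eps * m)\<close> alone, so the
  system turns into ordinary differential equations in \<open>z\<close>; \<open>V\<close> is the
  derivative of \<open>X\<close>.\<close>

lemma profile_solves_navier_stokes:
  fixes e \<mu> :: "'n::finite \<Rightarrow> real \<Rightarrow> real \<Rightarrow> real" and S :: "real \<Rightarrow> real^'n"
  assumes smooth: "\<And>i. smooth2 (e i)" and temp_pos: "\<And>i x r. 0 < x \<Longrightarrow> 0 < temp e i x r"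
    and visc_pos: "\<And>x s. 0 < x \<Longrightarrow> 0 < total_visc \<mu> x s"
    and nz: "eps \<noteq> 0" "m \<noteq> 0"
    and wp: "wave_profile e \<mu> m (\<tau>L, sL) \<omega>R X S"
    and V_def: "V = (\<lambda>z. jumpF e m \<tau>L sL (X z) (S z) / total_visc \<mu> (X z) (S z))"
    and V': "\<And>z. (V has_real_derivative V' z) (at z)" "continuous_on UNIV V'"
    and S1: "\<And>z. (S has_vector_derivative S1 z) (at z)"
    and S2: "\<And>z. (S1 has_vector_derivative S2 z) (at z)" "continuous_on UNIV S2"
  shows "navier_stokes_solution e \<mu> eps (\<lambda>t x. X ((x - \<sigma> * t) / (eps * m)))
    (\<lambda>t x. \<sigma> + m * X ((x - \<sigma> * t) / (eps * m))) (\<lambda>t x. S ((x - \<sigma> * t) / (eps * m)))"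
proof -
  let ?c = "eps * m"
  define M where "M = (\<lambda>z. total_visc \<mu> (X z) (S z))"
  have X_pos: "0 < X z" and X': "(X has_real_derivative V z) (at z)"
    and S': "((\<lambda>z. S z $ i) has_real_derivative \<mu> i (X z) (S z $ i) * (V z)\<^sup>2 / temp e i (X z) (S z $ i)) (at z)"
    for z i
    using wp by (auto simp: wave_profile_def V_def Let_def power_divide)
  have u': "((\<lambda>z. \<sigma> + m * X z) has_real_derivative m * V z) (at z)" for z
    by (auto intro!: derivative_eq_intros X')
  have mV': "((\<lambda>z. m * V z) has_real_derivative m * V' z) (at z)" for z
    by (auto intro!: derivative_eq_intros V')
  have C2: "Ck_on 2 UNIV (\<lambda>(t, x). w ((x - \<sigma> * t) / ?c))"
    if "\<And>z. (w has_vector_derivative w1 z) (at z)" "\<And>z. (w1 has_vector_derivative w2 z) (at z)"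
      "continuous_on UNIV w2" for w w1 w2 :: "real \<Rightarrow> 'b::real_normed_vector"
    using Ck_on_2_plane_wave[OF that plane_wave_bounded_linear[of \<sigma> ?c]] by (simp add: case_prod_unfold)
  note rv = has_real_derivative_iff_has_vector_derivative[THEN iffD1]
  have CX: "Ck_on 2 UNIV (\<lambda>(t, x). X ((x - \<sigma> * t) / ?c))"
    by (rule C2[OF rv[OF X'] rv[OF V'(1)] V'(2)])
  have Cu: "Ck_on 2 UNIV (\<lambda>(t, x). \<sigma> + m * X ((x - \<sigma> * t) / ?c))"
    by (rule C2[OF rv[OF u'] rv[OF mV']]) (intro continuous_intros V')
  have CS: "Ck_on 2 UNIV (\<lambda>(t, x). S ((x - \<sigma> * t) / ?c))"
    by (rule C2[OF S1 S2])
  have Dxu: "Dx (\<lambda>t x. \<sigma> + m * X ((x - \<sigma> * t) / ?c)) t x = m * V ((x - \<sigma> * t) / ?c) / ?c" for t x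
    by (rule Dx_plane_wave[OF u'])
  have \<rho>': "((\<lambda>z. 1 / X z) has_real_derivative - V z / (X z)\<^sup>2) (at z)" for z
    using X_pos[of z] by (auto intro!: derivative_eq_intros X' simp: power2_eq_square)
  have \<rho>u': "((\<lambda>z. 1 / X z * (\<sigma> + m * X z)) has_real_derivative - \<sigma> * V z / (X z)\<^sup>2) (at z)" for z
    using X_pos[of z]
    by (auto intro!: derivative_eq_intros X' simp: power2_eq_square field_simps)
  have mass: "Dt (\<lambda>t x. 1 / X ((x - \<sigma> * t) / ?c)) t x
      + Dx (\<lambda>t x. 1 / X ((x - \<sigma> * t) / ?c) * (\<sigma> + m * X ((x - \<sigma> * t) / ?c))) t x = 0" for t x
    by (simp only: Dt_plane_wave[OF \<rho>'] Dx_plane_wave[OF \<rho>u']) simp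
  have momentum: "Dt (\<lambda>t x. 1 / X ((x - \<sigma> * t) / ?c) * (\<sigma> + m * X ((x - \<sigma> * t) / ?c))) t x
      + Dx (\<lambda>t x. 1 / X ((x - \<sigma> * t) / ?c) * (\<sigma> + m * X ((x - \<sigma> * t) / ?c))\<^sup>2
          + total_pres e (X ((x - \<sigma> * t) / ?c)) (S ((x - \<sigma> * t) / ?c))) t x
      = eps * Dx (\<lambda>t x. M ((x - \<sigma> * t) / ?c) *
          Dx (\<lambda>t x. \<sigma> + m * X ((x - \<sigma> * t) / ?c)) t x) t x" for t x
  proof -
    define z where "z = (x - \<sigma> * t) / ?c"
    obtain P' where P': "((\<lambda>z. total_pres e (X z) (S z)) has_real_derivative P') (at z)"
      using total_pres_chain[where e = e and X = X and S = S and t = z, OF smooth X_pos X' S'] by blast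
    have flux: "((\<lambda>z. 1 / X z * (\<sigma> + m * X z)\<^sup>2 + total_pres e (X z) (S z)) has_real_derivative
        - \<sigma>\<^sup>2 * V z / (X z)\<^sup>2 + m\<^sup>2 * V z + P') (at z)"
      using X_pos[of z]
      by (auto intro!: derivative_eq_intros X' P' simp: power2_eq_square field_simps)
    have F': "((\<lambda>z. jumpF e m \<tau>L sL (X z) (S z) / eps) has_real_derivative (P' + m\<^sup>2 * V z) / eps) (at z)"
      unfolding jumpF_def by (rule DERIV_cdivide) (auto intro!: derivative_eq_intros X' P')
    \<comment> \<open>The profile equation cancels the viscosity, so the viscous stress is
      \<open>F / eps\<close> and differentiating it involves no derivative of
      \<open>\<mu>\<close>.\<close>
    have "M z * (m * V z / ?c) = jumpF e m \<tau>L sL (X z) (S z) / eps" for z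
      using visc_pos[OF X_pos, of z "S z"] nz by (simp add: V_def M_def)
    then have "Dx (\<lambda>t x. M ((x - \<sigma> * t) / ?c) * (m * V ((x - \<sigma> * t) / ?c) / ?c)) t x = (P' + m\<^sup>2 * V z) / eps / ?c"
      using Dx_plane_wave[OF F'[unfolded z_def]] by (simp add: z_def)
    then show ?thesis
      unfolding Dxu Dt_plane_wave[OF \<rho>u'] Dx_plane_wave[OF flux[unfolded z_def]]
      using nz by (simp add: z_def field_simps power2_eq_square)
  qed
  have energy: "Dt (\<lambda>t x. 1 / X ((x - \<sigma> * t) / ?c) * e i (X ((x - \<sigma> * t) / ?c)) (S ((x - \<sigma> * t) / ?c) $ i)) t x
      + Dx (\<lambda>t x. 1 / X ((x - \<sigma> * t) / ?c) * (\<sigma> + m * X ((x - \<sigma> * t) / ?c))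
          * e i (X ((x - \<sigma> * t) / ?c)) (S ((x - \<sigma> * t) / ?c) $ i)) t x
      + pres e i (X ((x - \<sigma> * t) / ?c)) (S ((x - \<sigma> * t) / ?c) $ i)
          * Dx (\<lambda>t x. \<sigma> + m * X ((x - \<sigma> * t) / ?c)) t x
      = eps * \<mu> i (X ((x - \<sigma> * t) / ?c)) (S ((x - \<sigma> * t) / ?c) $ i)
          * (Dx (\<lambda>t x. \<sigma> + m * X ((x - \<sigma> * t) / ?c)) t x)\<^sup>2" for i t x
  proof -
    define z where "z = (x - \<sigma> * t) / ?c"
    \<comment> \<open>The temperature cancels against the denominator of the entropy equation,
      leaving the dissipation term.\<close>
    define E' where "E' = D1 (e i) (X z) (S z $ i) * V z + \<mu> i (X z) (S z $ i) * (V z)\<^sup>2"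
    have E': "((\<lambda>z. e i (X z) (S z $ i)) has_real_derivative E') (at z)"
      using smooth2_chain[where f = "e i" and X = X and Y = "\<lambda>z. S z $ i" and t = z, OF smooth X_pos X' S'] temp_pos[OF X_pos, of i z "S z $ i"]
      by (simp add: E'_def temp_eq)
    have \<rho>E: "((\<lambda>z. 1 / X z * e i (X z) (S z $ i)) has_real_derivative
        E' / X z - V z / (X z)\<^sup>2 * e i (X z) (S z $ i)) (at z)"
      by (rule DERIV_cong[OF DERIV_mult[OF \<rho>' E']]) simp
    \<comment> \<open>As \<open>\<rho> u = \<sigma> / X + m\<close>, the part with factor
      \<open>\<sigma>\<close> cancels the time derivative and only \<open>m * E'\<close>
      survives.\<close>
    have \<rho>uE: "((\<lambda>z. 1 / X z * (\<sigma> + m * X z) * e i (X z) (S z $ i)) has_real_derivative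
        \<sigma> * (E' / X z - V z / (X z)\<^sup>2 * e i (X z) (S z $ i)) + m * E') (at z)"
      by (rule DERIV_cong[OF DERIV_mult[OF \<rho>u' E']]) (use X_pos[of z] in \<open>simp add: field_simps\<close>)
    show ?thesis
      unfolding Dxu Dt_plane_wave[OF \<rho>E[unfolded z_def]] Dx_plane_wave[OF \<rho>uE[unfolded z_def]]
      unfolding z_def[symmetric] pres_eq E'_def
      using nz by (simp add: field_simps power2_eq_square)
  qed
  show ?thesis
    unfolding navier_stokes_solution_def Let_def
    using CX Cu CS X_pos mass momentum energy by (simp add: M_def)
qed

section \<open>Reduction to a ray of entropies\<close>

definition ray_energy ::
  "('n::finite \<Rightarrow> real \<Rightarrow> real \<Rightarrow> real) \<Rightarrow> real^'n \<Rightarrow> real^'n \<Rightarrow> real \<Rightarrow> real \<Rightarrow> real" where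
  "ray_energy e s a x y = (\<Sum>i\<in>UNIV. e i x (s $ i + y * a $ i))"

lemma smooth2_ray_energy:
  assumes "\<And>i. smooth2 (e i)"
  shows "smooth2 (ray_energy e s a)"
  using smooth2_sum_compose_affine[of e "\<lambda>i. s $ i" "\<lambda>i. a $ i", OF assms]
  by (simp add: ray_energy_def[abs_def])

lemma total_energy_ray: "total_energy e x (s + y *\<^sub>R a) = ray_energy e s a x y"
  by (simp add: total_energy_def ray_energy_def)

lemma total_pres_ray:
  assumes "\<And>i. smooth2 (e i)" "0 < x"
  shows "total_pres e x (s + y *\<^sub>R a) = - D1 (ray_energy e s a) x y"
proof -
  have "((\<lambda>x. \<Sum>i\<in>UNIV. e i x (s $ i + y * a $ i)) has_real_derivative
      (\<Sum>i\<in>UNIV. D1 (e i) x (s $ i + y * a $ i))) (at x)"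
    by (intro DERIV_sum smooth2_D1_works assms)
  then have "D1 (ray_energy e s a) x y = (\<Sum>i\<in>UNIV. D1 (e i) x (s $ i + y * a $ i))"
    unfolding D1_def[of "ray_energy e s a"] ray_energy_def by (rule DERIV_imp_deriv)
  then show ?thesis by (simp add: total_pres_def pres_eq sum_negf)
qed

text \<open>The right-hand side is the total viscosity on the ray for the laws
  \<open>a $ i * temp e i\<close>.\<close>

lemma D2_ray_energy:
  assumes "\<And>i. smooth2 (e i)" "0 < x"
  shows "D2 (ray_energy e s a) x y = (\<Sum>i\<in>UNIV. a $ i * temp e i x (s $ i + y * a $ i))"
proof -
  have "((\<lambda>y. e i x (s $ i + y * a $ i)) has_real_derivative a $ i * temp e i x (s $ i + y * a $ i)) (at y)" for i
  proof -
    have "((\<lambda>y. s $ i + y * a $ i) has_real_derivative a $ i) (at y)"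
      by (auto intro!: derivative_eq_intros)
    from DERIV_chain2[where f = "e i x" and g = "\<lambda>y. s $ i + y * a $ i", OF smooth2_D2_works[OF assms] this]
    show ?thesis by (simp add: temp_eq mult.commute)
  qed
  then have "((\<lambda>y. \<Sum>i\<in>UNIV. e i x (s $ i + y * a $ i)) has_real_derivative
      (\<Sum>i\<in>UNIV. a $ i * temp e i x (s $ i + y * a $ i))) (at y)"
    by (rule DERIV_sum)
  then show ?thesis
    unfolding D2_def ray_energy_def by (rule DERIV_imp_deriv)
qed

lemma total_pres_dtau_ray:
  assumes "\<And>i. smooth2 (e i)" "0 < x"
  shows "total_pres_dtau e x (s + y *\<^sub>R a) = - D1 (D1 (ray_energy e s a)) x y"
proof -
  have "((\<lambda>t. - D1 (ray_energy e s a) t y) has_real_derivative - D1 (D1 (ray_energy e s a)) x y) (at x)"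
    by (intro DERIV_minus smooth2_D1_works smooth2_D1 smooth2_ray_energy assms)
  then have "((\<lambda>t. total_pres e t (s + y *\<^sub>R a)) has_real_derivative - D1 (D1 (ray_energy e s a)) x y) (at x)"
    by (rule has_field_derivative_transform_within_open[of _ _ _ "{0<..}"])
       (use assms(2) total_pres_ray[where e = e, OF assms(1)] in auto)
  then show ?thesis unfolding total_pres_dtau_def by (rule DERIV_imp_deriv)
qed

lemma deriv_total_pres_dtau_ray:
  assumes "\<And>i. smooth2 (e i)" "0 < x"
  shows "((\<lambda>t. total_pres_dtau e t (s + y *\<^sub>R a)) has_real_derivative
    - D1 (D1 (D1 (ray_energy e s a))) x y) (at x)"
proof -
  have "((\<lambda>t. - D1 (D1 (ray_energy e s a)) t y) has_real_derivative
      - D1 (D1 (D1 (ray_energy e s a))) x y) (at x)"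
    by (intro DERIV_minus smooth2_D1_works smooth2_D1 smooth2_ray_energy assms)
  then show ?thesis
    by (rule has_field_derivative_transform_within_open[of _ _ _ "{0<..}"])
       (use assms(2) total_pres_dtau_ray[where e = e, OF assms(1)] in auto)
qed

section \<open>Hypotheses of the scalar problem and admissible viscosities\<close>

lemma filterlim_sum_at_top:
  fixes f :: "'i \<Rightarrow> 'a \<Rightarrow> real"
  assumes "finite I" "j \<in> I" "filterlim (f j) at_top A"
    and "\<And>i. i \<in> I \<Longrightarrow> \<forall>\<^sub>F x in A. c i \<le> f i x"
  shows "LIM x A. (\<Sum>i\<in>I. f i x) :> at_top"
proof (rule filterlim_at_top_mono)
  show "LIM x A. sum c (I - {j}) + f j x :> at_top"
    by (rule filterlim_tendsto_add_at_top[OF tendsto_const assms(3)])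
  have "\<forall>\<^sub>F x in A. \<forall>i\<in>I. c i \<le> f i x"
    using assms(1,4) by (simp add: eventually_ball_finite)
  then show "\<forall>\<^sub>F x in A. sum c (I - {j}) + f j x \<le> (\<Sum>i\<in>I. f i x)"
  proof eventually_elim
    case (elim x)
    then have "sum c (I - {j}) \<le> (\<Sum>i\<in>I - {j}. f i x)" by (intro sum_mono) auto
    then show ?case using sum.remove[OF assms(1,2), of "\<lambda>i. f i x"] by simp
  qed
qed

text \<open>The \<open>\<tau>\<close>-derivative of the pressure is strictly increasing in
  \<open>\<tau>\<close> and tends to 0 at infinity.\<close>

lemma total_pres_dtau_neg:
  fixes e :: "'n::finite \<Rightarrow> real \<Rightarrow> real \<Rightarrow> real"
  assumes smooth: "\<And>i. smooth2 (e i)" and th: "thermodynamic_assumptions e" and "0 < x"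
  shows "total_pres_dtau e x s < 0"
proof -
  let ?q = "\<lambda>t. total_pres_dtau e t s"
  have mono: "?q t < ?q t'" if "0 < t" "t < t'" for t t'
  proof (rule DERIV_pos_imp_increasing[OF that(2)])
    fix z assume "t \<le> z" "z \<le> t'"
    then have z: "0 < z" using that by simp
    \<comment> \<open>The degenerate ray with \<open>a = 0\<close> transfers the ray formula to an
      arbitrary \<open>s\<close>.\<close>
    have "?q differentiable (at z)"
      using deriv_total_pres_dtau_ray[where e = e and s = s and y = 0 and a = 0, OF smooth z]
      by (auto simp: real_differentiable_def)
    then have "(?q has_real_derivative deriv ?q z) (at z)"
      using DERIV_deriv_iff_real_differentiable by blast
    moreover have "0 < deriv ?q z" using th z by (simp add: thermodynamic_assumptions_def)
    ultimately show "\<exists>w. (?q has_real_derivative w) (at z) \<and> 0 < w" by blast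
  qed
  have "(?q \<longlongrightarrow> 0) at_top" using th by (simp add: thermodynamic_assumptions_def)
  then have "?q (x + 1) \<le> 0"
  proof (rule tendsto_lowerbound)
    show "\<forall>\<^sub>F t in at_top. ?q (x + 1) \<le> ?q t"
      using eventually_gt_at_top[of "x + 1"]
      by eventually_elim (use mono[of "x + 1"] \<open>0 < x\<close> in \<open>auto intro: less_imp_le\<close>)
  qed simp
  with mono[of x "x + 1"] \<open>0 < x\<close> show ?thesis by simp
qed

text \<open>No component of \<open>a\<close> is negative and some \<open>a $ j\<close> is positive:
  all summands behave weakly as required along the ray, and the index \<open>j\<close> supplies
  strictness and growth.\<close>

lemma scalar_shock_ray:
  fixes e :: "'n::finite \<Rightarrow> real \<Rightarrow> real \<Rightarrow> real" and a :: "real^'n"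
  assumes e: "internal_energies e" and th: "thermodynamic_assumptions e"
    and "0 < \<tau>L" and lax: "- total_pres_dtau e \<tau>L sL < m\<^sup>2" and a: "a \<in> sphere_plus"
  shows "scalar_shock (ray_energy e sL a) \<tau>L m"
proof
  have smooth: "smooth2 (e i)" for i using e by (simp add: internal_energies_def)
  have temp_pos: "0 < temp e i x r" if "0 < x" for i x r
    using e that by (simp add: internal_energies_def)
  have a_nonneg: "0 \<le> a $ i" for i using a by (simp add: sphere_plus_def)
  have "a \<noteq> 0" using a by (auto simp: sphere_plus_def)
  then obtain j where "a $ j \<noteq> 0" by (auto simp: vec_eq_iff)
  then have j: "0 < a $ j" using a_nonneg[of j] by simp
  note ev = th[unfolded thermodynamic_assumptions_def]
  show "smooth2 (ray_energy e sL a)" by (rule smooth2_ray_energy[OF smooth])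
  show "0 < \<tau>L" by fact
  show "0 < D2 (ray_energy e sL a) x y" if "0 < x" for x y
    unfolding D2_ray_energy[where e = e, OF smooth that]
    using a_nonneg j temp_pos[OF that]
    by (intro sum_pos2[of _ j]) (simp_all add: less_imp_le[OF temp_pos[OF that]])
  show "D1 (ray_energy e sL a) x y' < D1 (ray_energy e sL a) x y" if "0 < x" "y < y'" for x y y'
  proof -
    have mono: "pres e i x r < pres e i x r'" if "r < r'" for i r r'
    proof (rule DERIV_pos_imp_increasing[OF that])
      fix q
      have "((\<lambda>q. pres e i x q) has_real_derivative - D2 (D1 (e i)) x q) (at q)"
        unfolding pres_eq by (intro DERIV_minus smooth2_D2_works smooth2_D1 smooth \<open>0 < x\<close>)
      moreover from DERIV_imp_deriv[OF this] have "0 < - D2 (D1 (e i)) x q"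
        using ev \<open>0 < x\<close> by metis
      ultimately show "\<exists>w. ((\<lambda>q. pres e i x q) has_real_derivative w) (at q) \<and> 0 < w" by blast
    qed
    have "total_pres e x (sL + y *\<^sub>R a) < total_pres e x (sL + y' *\<^sub>R a)"
      unfolding total_pres_def
    proof (rule sum_strict_mono_ex1)
      show "\<forall>i\<in>UNIV. pres e i x ((sL + y *\<^sub>R a) $ i) \<le> pres e i x ((sL + y' *\<^sub>R a) $ i)"
      proof
        fix i
        have "y * a $ i \<le> y' * a $ i" using that a_nonneg[of i] by (intro mult_right_mono) auto
        then show "pres e i x ((sL + y *\<^sub>R a) $ i) \<le> pres e i x ((sL + y' *\<^sub>R a) $ i)"
          using mono[of "sL $ i + y * a $ i" "sL $ i + y' * a $ i" i]
          by (cases "y * a $ i = y' * a $ i") (auto simp: less_le)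
      qed
      show "\<exists>i\<in>UNIV. pres e i x ((sL + y *\<^sub>R a) $ i) < pres e i x ((sL + y' *\<^sub>R a) $ i)"
        using that j by (intro bexI[of _ j] mono) auto
    qed simp
    then show ?thesis using total_pres_ray[where e = e, OF smooth \<open>0 < x\<close>] by simp
  qed
  show "D1 (D1 (D1 (ray_energy e sL a))) x y < 0" if "0 < x" for x y
  proof -
    have "0 < deriv (\<lambda>t. total_pres_dtau e t (sL + y *\<^sub>R a)) x" using ev that by blast
    then show ?thesis
      using DERIV_imp_deriv[OF deriv_total_pres_dtau_ray[where e = e and s = sL and y = y and a = a, OF smooth that]] by simp
  qed
  show "D1 (D1 (ray_energy e sL a)) \<tau>L 0 < m\<^sup>2"
    using total_pres_dtau_ray[where e = e and s = sL and y = 0 and a = a, OF smooth \<open>0 < \<tau>L\<close>] lax by simp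
  show "LIM x at_right 0. ray_energy e sL a x 0 :> at_top"
  proof -
    have lim: "filterlim (\<lambda>x. e i x (sL $ i)) at_top (at_right 0)" for i using ev by blast
    have "LIM x at_right 0. (\<Sum>i\<in>UNIV. e i x (sL $ i)) :> at_top"
      by (rule filterlim_sum_at_top[where j = j and c = "\<lambda>i. 0"])
         (use lim in \<open>auto simp: filterlim_at_top\<close>)
    then show ?thesis by (simp add: ray_energy_def)
  qed
  show "LIM y at_top. ray_energy e sL a x y :> at_top" if "0 < x" for x
    unfolding ray_energy_def
  proof (rule filterlim_sum_at_top[where j = j and c = "\<lambda>i. e i x (sL $ i)"])
    have "LIM y at_top. sL $ j + y * a $ j :> at_top"
      by (intro filterlim_tendsto_add_at_top[OF tendsto_const]
          filterlim_at_top_mult_tendsto_pos[OF tendsto_const j] filterlim_ident)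
    moreover have "filterlim (\<lambda>r. e j x r) at_top at_top" using ev that by blast
    ultimately show "LIM y at_top. e j x (sL $ j + y * a $ j) :> at_top"
      by (rule filterlim_compose[rotated])
    fix i
    have mono: "e i x r < e i x r'" if "r < r'" for r r'
    proof (rule DERIV_pos_imp_increasing[OF that])
      fix q
      show "\<exists>w. ((\<lambda>q. e i x q) has_real_derivative w) (at q) \<and> 0 < w"
        using smooth2_D2_works[OF smooth \<open>0 < x\<close>] temp_pos[OF \<open>0 < x\<close>, unfolded temp_eq] by blast
    qed
    show "\<forall>\<^sub>F y in at_top. e i x (sL $ i) \<le> e i x (sL $ i + y * a $ i)"
      using eventually_ge_at_top[of 0]
    proof eventually_elim
      case (elim y)
      then have "0 \<le> y * a $ i" using a_nonneg[of i] by simp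
      then show ?case using mono[of "sL $ i" "sL $ i + y * a $ i"]
        by (cases "y * a $ i = 0") (auto simp: less_le)
    qed
  qed auto
qed

text \<open>Some laws may vanish identically, but one index with \<open>0 < a $ j\<close> keeps the
  sum positive at every state, on or off the ray.\<close>

lemma viscosity_laws_ray:
  fixes e :: "'n::finite \<Rightarrow> real \<Rightarrow> real \<Rightarrow> real" and a :: "real^'n"
  assumes e: "internal_energies e" and a: "a \<in> sphere_plus"
  shows "viscosity_laws (\<lambda>i x r. a $ i * temp e i x r)"
  unfolding viscosity_laws_def
proof (intro conjI allI impI)
  have temp_pos: "0 < temp e i x r" if "0 < x" for i x r
    using e that by (simp add: internal_energies_def)
  have a_nonneg: "0 \<le> a $ i" for i using a by (simp add: sphere_plus_def)
  have "a \<noteq> 0" using a by (auto simp: sphere_plus_def)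
  then obtain j where "a $ j \<noteq> 0" by (auto simp: vec_eq_iff)
  then have j: "0 < a $ j" using a_nonneg[of j] by simp
  have nonneg: "0 \<le> a $ i * temp e i x r" if "0 < x" for i x r
    using a_nonneg[of i] temp_pos[OF that, of i r] by (intro mult_nonneg_nonneg) simp_all
  show "0 \<le> a $ i * temp e i x r" if "0 < x" for i x r by (rule nonneg[OF that])
  show "0 < (\<Sum>i\<in>UNIV. a $ i * temp e i x (s $ i))" if "0 < x" for x and s :: "real^'n"
    using nonneg[OF that] j temp_pos[OF that] by (intro sum_pos2[of _ j]) auto
  fix i
  have "smooth2 (e i)" using e by (simp add: internal_energies_def)
  then have "smooth2 (D2 (e i))" by (rule smooth2_D2)
  then have "smooth_on ({0<..} \<times> UNIV) (\<lambda>z. a $ i * (\<lambda>(x, y). D2 (e i) x y) z)"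
    unfolding smooth_on_def using Ck_on_cmult[OF open_halfplane] by blast
  then show "smooth_on ({0<..} \<times> UNIV) (\<lambda>(x, r). a $ i * temp e i x r)"
    by (simp add: temp_eq case_prod_unfold)
qed

theorem lemma5p2:
  fixes e :: "'n::finite \<Rightarrow> real \<Rightarrow> real \<Rightarrow> real"
    and \<tau>L uL \<sigma> :: real and sL sR :: "real^'n"
  assumes "internal_energies e"
    and "thermodynamic_assumptions e"
    and "0 < \<tau>L"
    and "(uL - \<sigma>) / sound_speed e \<tau>L sL > 1"
    and "sR \<in> entropy_set e (mass_flux \<tau>L uL \<sigma>) \<tau>L sL"
  shows "\<exists>\<mu>. viscosity_laws \<mu> \<and>
           (\<exists>\<tau>R>0. \<forall>eps>0. \<exists>\<tau> u s. traveling_wave e \<mu> eps uL \<sigma> (\<tau>L, sL) (\<tau>R, sR) \<tau> u s)"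
proof -
  define m where "m = mass_flux \<tau>L uL \<sigma>"
  have smooth: "smooth2 (e i)" for i using assms(1) by (simp add: internal_energies_def)
  have temp_pos: "0 < temp e i x r" if "0 < x" for i x r
    using assms(1) that by (simp add: internal_energies_def)
  \<comment> \<open>Positivity of \<open>q\<close> makes the sound speed the genuine root
    \<open>\<tau>L * sqrt q\<close>, so the Lax condition becomes \<open>0 < m\<close> and
    \<open>q < m\<^sup>2\<close>.\<close>
  define q where "q = - total_pres_dtau e \<tau>L sL"
  have q: "0 < q" using total_pres_dtau_neg[where e = e and s = sL, OF smooth assms(2,3)] by (simp add: q_def)
  have "- (\<tau>L\<^sup>2 * total_pres_dtau e \<tau>L sL) = \<tau>L\<^sup>2 * q" by (simp add: q_def)
  then have "sound_speed e \<tau>L sL = \<tau>L * sqrt q"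
    using assms(3) by (simp add: sound_speed_def real_sqrt_mult)
  then have "\<tau>L * sqrt q < uL - \<sigma>"
    using assms(3,4) q by (simp add: pos_less_divide_eq)
  then have "sqrt q < m"
    using assms(3) by (simp add: m_def mass_flux_def pos_less_divide_eq mult.commute)
  moreover have "0 < sqrt q" using q by simp
  ultimately have m: "0 < m" "q < m\<^sup>2"
    using power_strict_mono[of "sqrt q" m 2] q by (linarith, simp)
  obtain a where a: "a \<in> sphere_plus" "sR = sL + Lambda0 e m \<tau>L sL a *\<^sub>R a"
    using assms(5) by (auto simp: entropy_set_def m_def)
  interpret scalar_shock "ray_energy e sL a" \<tau>L m
    using scalar_shock_ray[OF assms(1-3) _ a(1)] m(2) by (simp add: q_def)
  have F_ray: "jumpF e m \<tau>L sL x (sL + y *\<^sub>R a) = F x y" if "0 < x" for x y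
    using total_pres_ray[where e = e and s = sL and y = y and a = a, OF smooth that] total_pres_ray[where e = e and s = sL and y = 0 and a = a, OF smooth x0_pos]
    by (simp add: jumpF_def F_def)
  have H_ray: "jumpH e m \<tau>L sL x (sL + y *\<^sub>R a) = H x y" if "0 < x" for x y
    using total_pres_ray[where e = e and s = sL and y = 0 and a = a, OF smooth x0_pos] total_energy_ray[of e x sL y a]
      total_energy_ray[of e \<tau>L sL 0 a]
    by (simp add: jumpH_def H_def)
  obtain L \<tau>R X Y where "0 < L" "0 < \<tau>R" "F \<tau>R L = 0" "H \<tau>R L = 0"
    and XY: "\<forall>t. 0 < X t \<and> (X has_real_derivative G (X t) (Y t)) (at t) \<and>
      (Y has_real_derivative (G (X t) (Y t))\<^sup>2) (at t)"
    and lim: "(X \<longlongrightarrow> \<tau>L) at_bot" "(Y \<longlongrightarrow> 0) at_bot" "(X \<longlongrightarrow> \<tau>R) at_top" "(Y \<longlongrightarrow> L) at_top"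
    using profile_exists by blast
  have X_pos: "0 < X t" and X': "(X has_real_derivative G (X t) (Y t)) (at t)"
    and Y': "(Y has_real_derivative (G (X t) (Y t))\<^sup>2) (at t)" for t
    using XY by auto
  \<comment> \<open>The end state of the profile witnesses existence, and
    \<open>zeros_unique\<close> shows that no other level qualifies.\<close>
  have "Lambda0 e m \<tau>L sL a = L"
    unfolding Lambda0_def
  proof (rule the_equality)
    show "0 < L \<and> (\<exists>\<tau>>0. jumpF e m \<tau>L sL \<tau> (sL + L *\<^sub>R a) = 0 \<and> jumpH e m \<tau>L sL \<tau> (sL + L *\<^sub>R a) = 0)"
      using \<open>0 < L\<close> \<open>0 < \<tau>R\<close> \<open>F \<tau>R L = 0\<close> \<open>H \<tau>R L = 0\<close> F_ray H_ray by (intro conjI exI[of _ \<tau>R]) auto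
    fix l assume "0 < l \<and> (\<exists>\<tau>>0. jumpF e m \<tau>L sL \<tau> (sL + l *\<^sub>R a) = 0 \<and> jumpH e m \<tau>L sL \<tau> (sL + l *\<^sub>R a) = 0)"
    then obtain x where "0 < l" "0 < x" "F x l = 0" "H x l = 0" using F_ray H_ray by auto
    then show "l = L"
      using zeros_unique[of x l \<tau>R L] \<open>0 < L\<close> \<open>0 < \<tau>R\<close> \<open>F \<tau>R L = 0\<close> \<open>H \<tau>R L = 0\<close> by simp
  qed
  then have sR: "sR = sL + L *\<^sub>R a" using a(2) by simp
  define \<mu> where "\<mu> = (\<lambda>i x r. a $ i * temp e i x r)"
  define S where "S = (\<lambda>t. sL + Y t *\<^sub>R a)"
  define V where "V = (\<lambda>t. G (X t) (Y t))"
  \<comment> \<open>The direction is \<open>(X', Y')\<close>, that is, \<open>V\<close> and its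
    square.\<close>
  define V' where "V' = (\<lambda>t. dG (X t) (Y t) (V t) ((V t)\<^sup>2))"
  have visc: "viscosity_laws \<mu>" unfolding \<mu>_def by (rule viscosity_laws_ray[OF assms(1) a(1)])
  then have visc_pos: "0 < total_visc \<mu> x s" if "0 < x" for x s
    using that by (simp add: viscosity_laws_def total_visc_def)
  have visc_ray: "total_visc \<mu> x (sL + y *\<^sub>R a) = D2 (ray_energy e sL a) x y" if "0 < x" for x y
    using D2_ray_energy[where e = e and s = sL and y = y and a = a, OF smooth that] by (simp add: total_visc_def \<mu>_def)
  have V_eq: "V = (\<lambda>t. jumpF e m \<tau>L sL (X t) (S t) / total_visc \<mu> (X t) (S t))"
    by (simp add: V_def S_def F_ray[OF X_pos] visc_ray[OF X_pos] G_def)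
  have V': "(V has_real_derivative V' t) (at t)" for t
    unfolding V_def V'_def by (rule G_chain[OF X_pos X' Y'])
  have cont: "continuous_on UNIV X" "continuous_on UNIV Y" "continuous_on UNIV V"
    using DERIV_isCont[OF X'] DERIV_isCont[OF Y'] DERIV_isCont[OF V']
    by (auto intro: continuous_at_imp_continuous_on)
  then have cont_V': "continuous_on UNIV V'"
    unfolding V'_def by (intro continuous_on_dG continuous_on_power X_pos)
  have profile: "wave_profile e \<mu> m (\<tau>L, sL) (\<tau>R, sR) X S"
    unfolding wave_profile_def Let_def fst_conv snd_conv
  proof (intro conjI allI)
    fix t i
    show "0 < X t" by (rule X_pos)
    show "(X has_real_derivative jumpF e m \<tau>L sL (X t) (S t) / total_visc \<mu> (X t) (S t)) (at t)"
      using X'[of t] V_eq by (simp add: V_def fun_eq_iff)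
    \<comment> \<open>Since \<open>\<mu> i\<close> divided by the temperature is
      \<open>a $ i\<close>, this is the required entropy equation.\<close>
    have "((\<lambda>t. S t $ i) has_real_derivative (V t)\<^sup>2 * a $ i) (at t)"
      unfolding S_def V_def by (auto intro!: derivative_eq_intros Y')
    moreover have "temp e i (X t) (S t $ i) \<noteq> 0"
      using temp_pos[OF X_pos] by (metis less_irrefl)
    ultimately show "((\<lambda>z. S z $ i) has_real_derivative
        \<mu> i (X t) (S t $ i) / ((total_visc \<mu> (X t) (S t))\<^sup>2 * temp e i (X t) (S t $ i))
          * (jumpF e m \<tau>L sL (X t) (S t))\<^sup>2) (at t)"
      by (simp add: V_eq \<mu>_def power_divide mult.commute)
  next
    have limL: "((\<lambda>t. (X t, S t)) \<longlongrightarrow> (\<tau>L, sL + 0 *\<^sub>R a)) at_bot"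
      unfolding S_def by (intro tendsto_intros lim)
    then show "((\<lambda>t. (X t, S t)) \<longlongrightarrow> (\<tau>L, sL)) at_bot" by simp
    have limR: "((\<lambda>t. (X t, S t)) \<longlongrightarrow> (\<tau>R, sR)) at_top"
      unfolding S_def sR by (intro tendsto_intros lim)
    then show "((\<lambda>t. (X t, S t)) \<longlongrightarrow> (\<tau>R, sR)) at_top" .
    show "\<not> (\<lambda>t. (X t, S t)) constant_on UNIV"
    proof
      assume "(\<lambda>t. (X t, S t)) constant_on UNIV"
      then obtain c where c: "\<And>t. (X t, S t) = c" by (auto simp: constant_on_def)
      \<comment> \<open>A constant profile would equal both of its limits, which differ by the
        nonzero vector \<open>L *\<^sub>R a\<close>.\<close>
      have "c = (\<tau>L, sL)" "c = (\<tau>R, sR)" using limL limR by (simp_all add: c tendsto_const_iff)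
      then have "L *\<^sub>R a = 0" using sR by simp
      then show False using \<open>0 < L\<close> a(1) by (auto simp: sphere_plus_def)
    qed
  qed
  have S1: "(S has_vector_derivative (V t)\<^sup>2 *\<^sub>R a) (at t)" for t
    unfolding S_def V_def
    by (rule derivative_eq_intros refl Y' | simp)+
  have S2: "((\<lambda>t. (V t)\<^sup>2 *\<^sub>R a) has_vector_derivative (2 * V t * V' t) *\<^sub>R a) (at t)" for t
    by (rule derivative_eq_intros refl V' | simp)+
  have cont_S2: "continuous_on UNIV (\<lambda>t. (2 * V t * V' t) *\<^sub>R a)"
    by (intro continuous_intros cont cont_V')
  have "traveling_wave e \<mu> eps uL \<sigma> (\<tau>L, sL) (\<tau>R, sR) (\<lambda>t x. X ((x - \<sigma> * t) / (eps * m)))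
      (\<lambda>t x. \<sigma> + m * X ((x - \<sigma> * t) / (eps * m))) (\<lambda>t x. S ((x - \<sigma> * t) / (eps * m)))" if "0 < eps" for eps
    unfolding traveling_wave_def Let_def fst_conv m_def[symmetric]
    using profile_solves_navier_stokes[where e = e and \<mu> = \<mu> and V = V and eps = eps, OF smooth temp_pos visc_pos _ _ profile V_eq V' cont_V' S1 S2 cont_S2]
      profile that m by blast
  then show ?thesis using visc \<open>0 < \<tau>R\<close> by blast
qed

end
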